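(* The coefficients $\phi$ and $\psi$ of the open Gromov-Witten potential of the elliptic orbifold $\mathbb{P}^1_{2,2,2,2}$ (given explicitly in the context), regarded as functions of $\tau$ with $q=e^{2\pi i\tau}$ and $q_{\mathrm d}=q^{1/8}$, are modular forms (of some weight, with possibly non-trivial multiplier system) for the modular group $\Gamma(2)$.
   Context: $\mathcal{H}$ is the upper half plane, $q=e^{2\pi i\tau}$ with $\tau\in\mathcal{H}$, $q^s=e^{2\pi i s\tau}$ for $s\in\mathbb{Q}$, and $\Gamma(2)$ is the principal congruence subgroup of level $2$ (considered in $\mathrm{PSL}(2,\mathbb{Z})$). A multiplier system for a congruence subgroup $\Gamma$ is a function $v:\Gamma\to\mathbb{C}$ with $|v(\gamma)|=1$ and $v(\gamma_1\gamma_2)=w(\gamma_1,\gamma_2)v(\gamma_1)v(\gamma_2)$ for some $w(\gamma_1,\gamma_2)$. A modular form of weight $k$ for $\Gamma$ with multiplier system $v$ is a holomorphic $f:\mathcal{H}\to\mathbb{C}$ with $f(\gamma\tau)=v(\gamma)(c\tau+d)^kf(\tau)$ for all $\gamma=\begin{pmatrix}a&b\\c&d\end{pmatrix}\in\Gamma$, such that for every $\gamma\in\mathrm{SL}(2,\mathbb{Z})$ the function $(c\tau+d)^{-k}f(\gamma\tau)$ has an expansion in non-negative fractional powers of $q$. The open Gromov-Witten potential of $\mathbb{P}^1_{2,2,2,2}$ is known to be $$W=\phi\left((xy)^2+(xw)^2+(zy)^2+(zw)^2\right)+\psi\,xyzw,$$ a function on the resolved conifold $\mathcal{O}_{\mathbb{P}^1}(-1)\oplus\mathcal{O}_{\mathbb{P}^1}(-1)=(\mathbb{C}^4\setminus\{x=z=0\})/\mathbb{C}^\times$,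 where $\lambda\cdot(x,y,z,w)=(\lambda x,\lambda^{-1}y,\lambda z,\lambda^{-1}w)$, and $$\phi=\sum_{k,l\ge0}(4k+1)q_{\mathrm d}^{(4k+1)(4l+1)}+\sum_{k,l\ge0}(4k+3)q_{\mathrm d}^{(4k+3)(4l+3)},\qquad \psi=\sum_{k,l\ge0}(k+l+1)q_{\mathrm d}^{(4k+1)(4l+3)}.$$ These formulas are to be taken as the definition of the potential. *)

theory Defs
  imports "HOL-Analysis.Analysis" "HOL-Algebra.Coset" "HOL-Number_Theory.Cong"
begin

section \<open>The modular group and its principal congruence subgroups\<close>

definition SL2Z :: "(int^2^2) monoid" where
  "SL2Z = \<lparr>carrier = {A. det A = 1}, mult = (**), one = mat 1\<rparr>"

text \<open>The elements of \<open>PSL2Z\<close> are the cosets \<open>{A, -A}\<close>.\<close>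

definition PSL2Z :: "(int^2^2) set monoid" where
  "PSL2Z = SL2Z Mod {mat 1, - mat 1}"

lemma group_SL2Z: "group SL2Z"
proof (rule groupI)
  fix A :: "int^2^2" assume A: "A \<in> carrier SL2Z"
  define B :: "int^2^2" where
    "B = (\<chi> i j. if i = j then (if i = 1 then A $ 2 $ 2 else A $ 1 $ 1) else - A $ i $ j)"
  have "B ** A = mat 1" "det B = 1"
    using A by (auto simp: SL2Z_def B_def det_2 vec_eq_iff matrix_matrix_mult_def sum_2 forall_2
        mat_def algebra_simps)
  then show "\<exists>B\<in>carrier SL2Z. B \<otimes>\<^bsub>SL2Z\<^esub> A = \<one>\<^bsub>SL2Z\<^esub>"
    by (auto simp: SL2Z_def)
qed (auto simp: SL2Z_def det_mul matrix_mul_assoc)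

lemma group_PSL2Z: "group PSL2Z"
proof -
  interpret group SL2Z by (rule group_SL2Z)
  have "- mat 1 \<in> carrier SL2Z" by (simp add: SL2Z_def det_2 mat_def)
  moreover have "- mat 1 \<otimes>\<^bsub>SL2Z\<^esub> A = - A" "A \<otimes>\<^bsub>SL2Z\<^esub> - mat 1 = - A" for A
    by (simp_all add: SL2Z_def vec_eq_iff matrix_matrix_mult_def sum_2 forall_2 mat_def)
  moreover have "mat 1 = \<one>\<^bsub>SL2Z\<^esub>" by (simp add: SL2Z_def)
  ultimately have "{mat 1, - mat 1} \<lhd> SL2Z" 
    using inv_equality[of "- mat 1" "- mat 1"]
    by (intro normalI subgroupI) (auto simp: r_coset_def l_coset_def)
  then show ?thesis unfolding PSL2Z_def by (rule normal.factorgroup_is_group)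
qed

definition PSL_class :: "int^2^2 \<Rightarrow> (int^2^2) set" where
  "PSL_class A = {mat 1, - mat 1} #>\<^bsub>SL2Z\<^esub> A"

definition PGamma :: "nat \<Rightarrow> (int^2^2) set set" where
  "PGamma N = PSL_class ` {A \<in> carrier SL2Z. \<forall>i j. [A $ i $ j = mat 1 $ i $ j] (mod int N)}"

section \<open>Modular forms with multiplier system\<close>

definition upper_half_plane :: "complex set" where
  "upper_half_plane = {\<tau>. Im \<tau> > 0}"

definition automorphy_factor :: "int^2^2 \<Rightarrow> complex \<Rightarrow> complex" where
  "automorphy_factor A \<tau> = of_int (A $ 2 $ 1) * \<tau> + of_int (A $ 2 $ 2)"

definition moebius_act :: "int^2^2 \<Rightarrow> complex \<Rightarrow> complex" where
  "moebius_act A \<tau> = (of_int (A $ 1 $ 1) * \<tau> + of_int (A $ 1 $ 2)) / automorphy_factor A \<tau>"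

text \<open>\<open>q_power s \<tau>\<close> is \<open>q\<^sup>s\<close> with the branch fixed by \<open>q = exp (2 \<pi> i \<tau>)\<close>.\<close>

definition q_power :: "rat \<Rightarrow> complex \<Rightarrow> complex" where
  "q_power s \<tau> = exp (2 * of_real pi * \<i> * of_rat s * \<tau>)"

definition multiplier_system ::
    "(int^2^2) set set \<Rightarrow> ((int^2^2) set \<Rightarrow> complex) \<Rightarrow> bool" where
  "multiplier_system \<Gamma> v \<longleftrightarrow>
     (\<forall>g\<in>\<Gamma>. cmod (v g) = 1) \<and>
     (\<exists>w. \<forall>g\<in>\<Gamma>. \<forall>h\<in>\<Gamma>. v (g \<otimes>\<^bsub>PSL2Z\<^esub> h) = w g h * v g * v h)"

text \<open>Non-negative fractional powers of \<open>q\<close> have a common denominator: the expansion is a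
  power series in the \<open>M\<close>-th root of \<open>q\<close> for some \<open>M > 0\<close>.\<close>

definition has_fractional_q_expansion :: "(complex \<Rightarrow> complex) \<Rightarrow> bool" where
  "has_fractional_q_expansion g \<longleftrightarrow>
     (\<exists>M>0. \<exists>a. \<forall>\<tau>\<in>upper_half_plane.
        (\<lambda>n. a n * q_power (of_nat n / of_nat M) \<tau>) sums g \<tau>)"

text \<open>The multiplier is a function on a subgroup of \<open>PSL(2,Z)\<close>, and the transformation law is
  required for both matrices representing each of its elements; hence only even weights admit
  nonzero forms.\<close>

definition modular_form ::
    "(int^2^2) set set \<Rightarrow> int \<Rightarrow> ((int^2^2) set \<Rightarrow> complex) \<Rightarrow> (complex \<Rightarrow> complex) \<Rightarrow> bool" where
  "modular_form \<Gamma> k v f \<longleftrightarrow>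
     multiplier_system \<Gamma> v \<and>
     f holomorphic_on upper_half_plane \<and>
     (\<forall>A\<in>carrier SL2Z. PSL_class A \<in> \<Gamma> \<longrightarrow>
        (\<forall>\<tau>\<in>upper_half_plane.
           f (moebius_act A \<tau>) = v (PSL_class A) * automorphy_factor A \<tau> powi k * f \<tau>)) \<and>
     (\<forall>A\<in>carrier SL2Z.
        has_fractional_q_expansion (\<lambda>\<tau>. automorphy_factor A \<tau> powi (- k) * f (moebius_act A \<tau>)))"

section \<open>The coefficients of the open Gromov-Witten potential\<close>

text \<open>The potential is
  \<open>W = \<phi> ((x y)\<^sup>2 + (x w)\<^sup>2 + (z y)\<^sup>2 + (z w)\<^sup>2) + \<psi> x y z w\<close>; its coefficients are given here as
  functions of \<open>q\<^sub>d\<close>. By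
  \<open>gw_series_abs_summable\<close> below, all three series converge absolutely for \<open>|q\<^sub>d| < 1\<close>.\<close>

definition gw_phi :: "complex \<Rightarrow> complex" where
  "gw_phi qd =
     (\<Sum>\<^sub>\<infinity>(k, l)\<in>UNIV. of_nat (4 * k + 1) * qd ^ ((4 * k + 1) * (4 * l + 1))) +
     (\<Sum>\<^sub>\<infinity>(k, l)\<in>UNIV. of_nat (4 * k + 3) * qd ^ ((4 * k + 3) * (4 * l + 3)))"

definition gw_psi :: "complex \<Rightarrow> complex" where
  "gw_psi qd = (\<Sum>\<^sub>\<infinity>(k, l)\<in>UNIV. of_nat (k + l + 1) * qd ^ ((4 * k + 1) * (4 * l + 3)))"

lemma gw_series_abs_summable:
  fixes qd :: complex
  assumes qd: "cmod qd < 1" and "a > 0" "b > 0"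
  shows "(\<lambda>p. norm (case p of (k, l) \<Rightarrow>
            of_nat (c * k + d * l + e) * qd ^ ((4 * k + a) * (4 * l + b))))
           summable_on (UNIV :: (nat \<times> nat) set)"
proof -
  define r where "r = cmod qd"
  have r: "0 \<le> r" "r < 1" using qd by (auto simp: r_def)
  define g where "g = (\<lambda>n. real (Suc n) * r ^ n)"
  have g_nonneg: "g n \<ge> 0" for n using r by (simp add: g_def)
  have "summable g"
    using geometric_deriv_sums[of r] r unfolding g_def sums_iff by simp
  then have g: "g summable_on UNIV"
    using g_nonneg by (intro norm_summable_imp_summable_on) simp
  have "(\<lambda>(k, l). g k * g l) summable_on (UNIV \<times> UNIV)"
  proof (rule summable_on_SigmaI)
    show "((\<lambda>l. case (k, l) of (k, l) \<Rightarrow> g k * g l) has_sum g k * infsum g UNIV) UNIV" for k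
      using has_sum_cmult_right[OF has_sum_infsum[OF g], of "g k"] by simp
    show "(\<lambda>k. g k * infsum g UNIV) summable_on UNIV"
      using summable_on_cmult_left[OF g] by blast
  qed (use g_nonneg in auto)
  then have *: "(\<lambda>p. (case p of (k, l) \<Rightarrow> g k * g l) * real (c + d + e)) summable_on UNIV"
    using summable_on_cmult_left by fastforce
  show ?thesis
  proof (rule Infinite_Sum.abs_summable_on_comparison_test'[OF *])
    fix p :: "nat \<times> nat"
    obtain k l where p: "p = (k, l)" by force
    have "k + l \<le> (4 * k + a) * (4 * l + b)"
    proof -
      have "k + l \<le> (4 * k + 1) * (4 * l + 1)" by (simp add: algebra_simps)
      also have "\<dots> \<le> (4 * k + a) * (4 * l + b)" using assms by (intro mult_mono) auto
      finally show ?thesis .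
    qed
    then have 1: "r ^ ((4 * k + a) * (4 * l + b)) \<le> r ^ (k + l)"
      using r by (intro power_decreasing) auto
    have "c * k + d * l + e \<le> (c + d + e) * (Suc k * Suc l)"
      by (simp add: algebra_simps)
    then have 2: "real (c * k + d * l + e) \<le> real ((c + d + e) * (Suc k * Suc l))"
      by (simp only: of_nat_le_iff)
    have "real (c * k + d * l + e) * r ^ ((4 * k + a) * (4 * l + b))
            \<le> real ((c + d + e) * (Suc k * Suc l)) * r ^ (k + l)"
      using r by (intro mult_mono 1 2) auto
    also have "\<dots> = g k * g l * real (c + d + e)"
      by (simp only: g_def of_nat_mult power_add mult_ac)
    finally show "norm (case p of (k, l) \<Rightarrow>
        of_nat (c * k + d * l + e) * qd ^ ((4 * k + a) * (4 * l + b)))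
      \<le> (case p of (k, l) \<Rightarrow> g k * g l) * real (c + d + e)"
      unfolding p prod.case norm_mult norm_power norm_of_nat r_def .
  qed
qed

end

(*
  With Q = q^(1/8), both potentials are Lambert series: phi = sum of d Q^(m d) over odd m, d with
  d = m (mod 4), and 4 psi is the same sum with d = -m (mod 4).  Expanding along rows with the
  Lipschitz formula  sum_n 1/(z+n)^2 = -4 pi^2 sum_d d exp(2 pi i d z)  shows that they are
  multiples of the weight 2 Eisenstein series

    sum over odd m and even n of i^(s m n / 2) / (m tau + n)^2,     s = -1 for phi, s = 1 for psi.

  Such a series converges only conditionally, but its weight changes sign under the translation
  by w = (0,4); adding the translated series therefore turns it into an absolutely convergent sum
  over all of Z^2, in which the action of SL(2,Z) merely permutes the terms (and moves w).  Under
  Gamma(2) the weight is multiplied by a power of i, and for all of SL(2,Z) the transformed weight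
  is again 8-periodic, so that the Lipschitz formula yields the expansion in powers of q^(1/8).
*)
theory Submission
  imports Defs "HOL-Complex_Analysis.Cauchy_Integral_Formula"
begin

section \<open>Sums of inverse squares over translates of the integers\<close>

lemma non_integer_facts:
  fixes z :: complex
  assumes "z \<notin> \<int>"
  shows "z \<notin> \<int>\<^sub>\<le>\<^sub>0" "1 - z \<notin> \<int>\<^sub>\<le>\<^sub>0" "sin (of_real pi * z) \<noteq> 0"
proof -
  have "1 - z \<notin> \<int>" using assms Ints_diff[of 1 "1 - z"] by auto
  then show "z \<notin> \<int>\<^sub>\<le>\<^sub>0" "1 - z \<notin> \<int>\<^sub>\<le>\<^sub>0" using assms nonpos_Ints_Int by blast+
  show "sin (of_real pi * z) \<noteq> 0"
    using assms sin_eq_0[of "of_real pi * z"] by (auto simp: mult.commute)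
qed

text \<open>By Euler's reflection formula
  \<open>Gamma u * Gamma (1 - u) * sin (of_real pi * u)\<close> is the constant \<pi> off the
  integers. Its derivative therefore vanishes, and cancelling the nonzero Gamma factors leaves the
  identity.\<close>

lemma Digamma_reflection:
  fixes z :: complex
  assumes "z \<notin> \<int>"
  shows "Digamma (1 - z) - Digamma z = of_real pi * cot (of_real pi * z)"
proof -
  have z: "z \<notin> \<int>\<^sub>\<le>\<^sub>0" "1 - z \<notin> \<int>\<^sub>\<le>\<^sub>0" and s: "sin (of_real pi * z) \<noteq> 0"
    using non_integer_facts[OF assms] by auto
  let ?f = "\<lambda>u::complex. Gamma u * Gamma (1 - u) * sin (of_real pi * u)"
  have "(?f has_field_derivative
          Gamma z * Gamma (1 - z) * ((Digamma z - Digamma (1 - z)) * sin (of_real pi * z)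
            + of_real pi * cos (of_real pi * z))) (at z)"
    using z by (auto intro!: derivative_eq_intros simp: algebra_simps)
  moreover have "(?f has_field_derivative 0) (at z)"
  proof (rule has_field_derivative_transform_within_open)
    show "((\<lambda>_. of_real pi) has_field_derivative 0) (at z)" by simp
    show "open (- \<int> :: complex set)" by (simp add: open_Compl)
    show "z \<in> - \<int>" using assms by simp
    show "of_real pi = ?f u" if "u \<in> - \<int>" for u
      using that Gamma_reflection_complex[of u] non_integer_facts(3)[of u] by simp
  qed
  ultimately have "Gamma z * Gamma (1 - z) * ((Digamma z - Digamma (1 - z)) * sin (of_real pi * z)
            + of_real pi * cos (of_real pi * z)) = 0"
    by (rule DERIV_unique)
  moreover have "Gamma z \<noteq> 0" "Gamma (1 - z) \<noteq> 0" using z by (simp_all add: Gamma_eq_zero_iff)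
  ultimately have "(Digamma z - Digamma (1 - z)) * sin (of_real pi * z) + of_real pi * cos (of_real pi * z) = 0"
    by simp
  then have "(Digamma (1 - z) - Digamma z) * sin (of_real pi * z) = of_real pi * cos (of_real pi * z)"
    by (simp add: algebra_simps)
  then show ?thesis using s by (simp add: cot_def eq_divide_eq)
qed

text \<open>A further differentiation of the reflection formula. The two trigamma values are the
  sums of 1/(z + n)^2 over n \<ge> 0 and over n < 0, so this evaluates the two-sided sum.\<close>

lemma Polygamma_1_reflection:
  fixes z :: complex
  assumes "z \<notin> \<int>"
  shows "Polygamma 1 z + Polygamma 1 (1 - z) = (of_real pi / sin (of_real pi * z)) ^ 2"
proof -
  have z: "z \<notin> \<int>\<^sub>\<le>\<^sub>0" "1 - z \<notin> \<int>\<^sub>\<le>\<^sub>0" and s: "sin (of_real pi * z) \<noteq> 0"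
    using non_integer_facts[OF assms] by auto
  let ?f = "\<lambda>u::complex. Digamma (1 - u) - Digamma u"
  have "(?f has_field_derivative - Polygamma 1 (1 - z) - Polygamma 1 z) (at z)"
    using z by (auto intro!: derivative_eq_intros simp: algebra_simps)
  moreover have "(?f has_field_derivative - ((of_real pi / sin (of_real pi * z)) ^ 2)) (at z)"
  proof (rule has_field_derivative_transform_within_open)
    show "((\<lambda>u. of_real pi * cot (of_real pi * u)) has_field_derivative
            - ((of_real pi / sin (of_real pi * z)) ^ 2)) (at z)"
      using s by (auto intro!: derivative_eq_intros DERIV_chain2[OF DERIV_cot]
          simp: field_simps power2_eq_square)
    show "open (- \<int> :: complex set)" by (simp add: open_Compl)
    show "z \<in> - \<int>" using assms by simp
    show "of_real pi * cot (of_real pi * u) = ?f u" if "u \<in> - \<int>" for u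
      using that Digamma_reflection[of u] by simp
  qed
  ultimately have "- Polygamma 1 (1 - z) - Polygamma 1 z = - ((of_real pi / sin (of_real pi * z)) ^ 2)"
    by (rule DERIV_unique)
  then show ?thesis by (simp add: algebra_simps)
qed

section \<open>Absolute convergence of lattice sums\<close>

lemma summable_on_int_powr:
  assumes "s > (1 :: real)"
  shows "(\<lambda>n::int. (1 + \<bar>real_of_int n\<bar>) powr - s) summable_on UNIV"
proof -
  have "summable (\<lambda>n. real (Suc n) powr - s)"
    using assms summable_real_powr_iff[of "- s"] by (subst summable_Suc_iff) auto
  then have nat: "(\<lambda>n. (1 + real n) powr - s) summable_on UNIV"
    by (intro summable_nonneg_imp_summable_on) (auto simp: add.commute)
  have 1: "(\<lambda>n::int. (1 + \<bar>real_of_int n\<bar>) powr - s) summable_on range int"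
    by (subst summable_on_reindex) (auto simp: o_def nat)
  have 2: "(\<lambda>n::int. (1 + \<bar>real_of_int n\<bar>) powr - s) summable_on range (\<lambda>n. - int n)"
    by (subst summable_on_reindex) (auto simp: o_def nat inj_on_def)
  have "UNIV = range int \<union> range (\<lambda>n. - int n)"
    by (auto simp: image_iff) (metis int_cases2)
  then show ?thesis using summable_on_union[OF 1 2] by simp
qed

text \<open>The imaginary part bounds |m|, and the triangle inequality then bounds |n|. A nonzero
  lattice point has |m| \<ge> 1 or |n| \<ge> 1, so its norm is bounded below; this absorbs the
  summand 1 at the price of doubling the constant.\<close>

lemma lattice_norm_lower_bound:
  fixes \<tau> :: complex
  assumes "Im \<tau> > 0"
  obtains K where "K > 0"
    "\<And>m n :: int. of_int m * \<tau> + of_int n \<noteq> 0 \<Longrightarrow>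
       1 + \<bar>real_of_int m\<bar> \<le> K * cmod (of_int m * \<tau> + of_int n) \<and>
       1 + \<bar>real_of_int n\<bar> \<le> K * cmod (of_int m * \<tau> + of_int n)"
proof -
  define K where "K = 1 / Im \<tau> + 1 + cmod \<tau> / Im \<tau>"
  have K: "K > 0" using assms by (simp add: K_def add_pos_nonneg)
  have *: "1 + \<bar>real_of_int m\<bar> \<le> 2 * K * cmod x \<and> 1 + \<bar>real_of_int n\<bar> \<le> 2 * K * cmod x"
    if x: "x = of_int m * \<tau> + of_int n" and nz: "x \<noteq> 0" for m n x
  proof -
    have "\<bar>real_of_int m\<bar> * Im \<tau> \<le> cmod x"
      using abs_Im_le_cmod[of x] assms by (simp add: x abs_mult)
    then have m: "\<bar>real_of_int m\<bar> \<le> cmod x / Im \<tau>" using assms by (simp add: field_simps)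
    also have "\<dots> \<le> K * cmod x" using assms by (simp add: K_def algebra_simps)
    finally have m': "\<bar>real_of_int m\<bar> \<le> K * cmod x" .
    have "\<bar>real_of_int n\<bar> = cmod (x - of_int m * \<tau>)" by (simp add: x)
    also have "\<dots> \<le> cmod x + \<bar>real_of_int m\<bar> * cmod \<tau>"
      by (rule order.trans[OF norm_triangle_ineq4]) (simp add: norm_mult)
    also have "\<dots> \<le> cmod x + cmod x / Im \<tau> * cmod \<tau>" by (intro add_left_mono mult_right_mono m) auto
    also have "\<dots> \<le> K * cmod x" using assms by (simp add: K_def algebra_simps)
    finally have n': "\<bar>real_of_int n\<bar> \<le> K * cmod x" .
    have "m \<noteq> 0 \<or> n \<noteq> 0" using x nz by auto
    then have "1 \<le> \<bar>real_of_int m\<bar> \<or> 1 \<le> \<bar>real_of_int n\<bar>" by auto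
    then have "1 \<le> K * cmod x" using m' n' by linarith
    then show ?thesis using m' n' by auto
  qed
  show ?thesis by (rule that[of "2 * K"]) (use K * in auto)
qed

text \<open>The summand at the origin is \<open>0\<close>, because \<open>1 / 0 = 0\<close>.\<close>

definition lattice_term :: "complex \<Rightarrow> int \<times> int \<Rightarrow> complex" where
  "lattice_term \<tau> = (\<lambda>(m, n). 1 / (of_int m * \<tau> + of_int n) ^ 2)"

lemma lattice_term_row_summable:
  assumes "Im \<tau> > 0"
  shows "(\<lambda>n. norm (lattice_term \<tau> (m, n))) summable_on UNIV"
proof -
  obtain K where K: "K > 0"
    "\<And>m n :: int. of_int m * \<tau> + of_int n \<noteq> 0 \<Longrightarrow>
       1 + \<bar>real_of_int m\<bar> \<le> K * cmod (of_int m * \<tau> + of_int n) \<and>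
       1 + \<bar>real_of_int n\<bar> \<le> K * cmod (of_int m * \<tau> + of_int n)"
    using lattice_norm_lower_bound[OF assms] by blast
  have "(\<lambda>n::int. K ^ 2 * (1 + \<bar>real_of_int n\<bar>) powr - 2) summable_on UNIV"
    by (intro summable_on_cmult_right summable_on_int_powr) simp
  then show ?thesis
  proof (rule Infinite_Sum.abs_summable_on_comparison_test')
    fix n :: int
    let ?x = "of_int m * \<tau> + of_int n"
    show "norm (lattice_term \<tau> (m, n)) \<le> K ^ 2 * (1 + \<bar>real_of_int n\<bar>) powr - 2"
    proof (cases "?x = 0")
      case False
      have "(1 + \<bar>real_of_int n\<bar>) ^ 2 \<le> (K * cmod ?x) ^ 2"
        using K(2)[OF False] by (intro power_mono) auto
      then have "1 / cmod ?x ^ 2 \<le> K ^ 2 / (1 + \<bar>real_of_int n\<bar>) ^ 2"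
        using False by (simp add: field_simps power_mult_distrib pos_le_divide_eq)
      moreover have "(1 + \<bar>real_of_int n\<bar>) powr 2 = (1 + \<bar>real_of_int n\<bar>) ^ 2"
        by (rule powr_numeral) simp
      then have "(1 + \<bar>real_of_int n\<bar>) powr - 2 = 1 / (1 + \<bar>real_of_int n\<bar>) ^ 2"
        by (simp only: powr_minus divide_inverse mult_1)
      ultimately show ?thesis by (simp add: lattice_term_def norm_divide norm_power)
    qed (simp add: lattice_term_def)
  qed
qed

text \<open>The difference factors as (y - x) (1/x) (1/y) (1/x + 1/y), and a b (a + b) \<le> a^3 +
  b^3 for a, b \<ge> 0 separates the variables. If x or y is 0, the bound holds with 1/0 = 0. For a
  fixed x - y the decay improves from exponent 2 to exponent 3, which suffices over a lattice of
  rank two.\<close>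

lemma lattice_term_difference_bound:
  "norm (1 / x ^ 2 - 1 / y ^ 2) \<le> norm (x - y) * (1 / norm x ^ 3 + 1 / norm y ^ 3)"
  for x y :: complex
proof (cases "x = 0 \<or> y = 0")
  case True
  then show ?thesis
    by (auto simp: norm_divide norm_mult power2_eq_square power3_eq_cube)
next
  case False
  define a b where "a = 1 / norm x" and "b = 1 / norm y"
  have ab: "a \<ge> 0" "b \<ge> 0" by (simp_all add: a_def b_def)
  have "1 / x ^ 2 - 1 / y ^ 2 = (y - x) * (1 / x * (1 / y)) * (1 / x + 1 / y)"
    using False by (simp add: field_simps power2_eq_square)
  then have "norm (1 / x ^ 2 - 1 / y ^ 2) = norm (x - y) * (a * b) * norm (1 / x + 1 / y)"
    by (simp add: norm_mult norm_divide norm_minus_commute a_def b_def)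
  also have "\<dots> \<le> norm (x - y) * (a * b) * (a + b)"
    using ab by (intro mult_left_mono order.trans[OF norm_triangle_ineq])
      (auto simp: norm_divide a_def b_def)
  also have "\<dots> = norm (x - y) * (a * b * (a + b))" by simp
  also have "\<dots> \<le> norm (x - y) * (a ^ 3 + b ^ 3)"
  proof (intro mult_left_mono)
    have "a ^ 3 + b ^ 3 - a * b * (a + b) = (a - b) ^ 2 * (a + b)"
      by (simp add: power2_eq_square power3_eq_cube algebra_simps)
    also have "\<dots> \<ge> 0" using ab by simp
    finally show "a * b * (a + b) \<le> a ^ 3 + b ^ 3" by simp
  qed simp
  finally show ?thesis by (simp add: a_def b_def power_one_over)
qed

lemma mult_self_powr_three_halves:
  fixes x :: real
  assumes "x > 0"
  shows "(x * x) powr (3 / 2) = x ^ 3"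
proof -
  have "(x * x) powr (3 / 2) = x powr (3 / 2) * x powr (3 / 2)" by (rule powr_mult)
  also have "\<dots> = x powr (3 / 2 + 3 / 2)" by (rule powr_add[symmetric])
  also have "\<dots> = x ^ 3" using assms by simp
  finally show ?thesis .
qed

text \<open>Multiplying the lower bounds in m and n shows that (1 + |m|) (1 + |n|) is at most a
  constant times |m \<tau> + n|^2 at nonzero points. Raised to the power 3/2, this dominates the
  inverse cubes by a product of two one-variable series, convergent since 3/2 > 1.\<close>

lemma lattice_cube_summable:
  assumes "Im \<tau> > 0"
  shows "(\<lambda>(m, n). 1 / cmod (of_int m * \<tau> + of_int n) ^ 3) summable_on (UNIV :: (int \<times> int) set)"
proof -
  obtain K where K: "K > 0"
    "\<And>m n :: int. of_int m * \<tau> + of_int n \<noteq> 0 \<Longrightarrow>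
       1 + \<bar>real_of_int m\<bar> \<le> K * cmod (of_int m * \<tau> + of_int n) \<and>
       1 + \<bar>real_of_int n\<bar> \<le> K * cmod (of_int m * \<tau> + of_int n)"
    using lattice_norm_lower_bound[OF assms] by blast
  define g where "g = (\<lambda>n::int. (1 + \<bar>real_of_int n\<bar>) powr - (3 / 2))"
  have g: "g summable_on UNIV" unfolding g_def by (rule summable_on_int_powr) simp
  have g_nonneg: "g n \<ge> 0" for n by (simp add: g_def)
  have "(\<lambda>(m, n). g m * g n) summable_on (UNIV \<times> UNIV)"
  proof (rule summable_on_SigmaI)
    show "((\<lambda>n. case (m, n) of (m, n) \<Rightarrow> g m * g n) has_sum g m * infsum g UNIV) UNIV" for m
      using has_sum_cmult_right[OF has_sum_infsum[OF g], of "g m"] by simp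
    show "(\<lambda>m. g m * infsum g UNIV) summable_on UNIV"
      using summable_on_cmult_left[OF g] by blast
  qed (use g_nonneg in auto)
  then have "(\<lambda>p. K ^ 3 * (case p of (m, n) \<Rightarrow> g m * g n)) summable_on UNIV"
    by (intro summable_on_cmult_right) simp
  then have "(\<lambda>p. norm (case p of (m, n) \<Rightarrow> 1 / cmod (of_int m * \<tau> + of_int n) ^ 3))
      summable_on (UNIV :: (int \<times> int) set)"
  proof (rule Infinite_Sum.abs_summable_on_comparison_test')
    fix p :: "int \<times> int"
    obtain m n where p: "p = (m, n)" by force
    let ?x = "cmod (of_int m * \<tau> + of_int n)"
    show "norm (case p of (m, n) \<Rightarrow> 1 / cmod (of_int m * \<tau> + of_int n) ^ 3)
        \<le> K ^ 3 * (case p of (m, n) \<Rightarrow> g m * g n)"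
    proof (cases "?x = 0")
      case False
      let ?a = "1 + \<bar>real_of_int m\<bar>" and ?b = "1 + \<bar>real_of_int n\<bar>"
      have x: "K * ?x > 0" using K False by simp
      have "(?a * ?b) powr (3 / 2) \<le> ((K * ?x) * (K * ?x)) powr (3 / 2)"
        using K(2)[of m n] False x by (intro powr_mono2 mult_mono) auto
      also have "\<dots> = (K * ?x) ^ 3"
        using x by (simp only: mult_self_powr_three_halves)
      finally have "?a powr (3 / 2) * ?b powr (3 / 2) \<le> (K * ?x) ^ 3" by (simp add: powr_mult)
      then have *: "?a powr (3 / 2) * ?b powr (3 / 2) \<le> K ^ 3 * ?x ^ 3"
        by (simp only: power_mult_distrib)
      have "1 / ?x ^ 3 \<le> K ^ 3 * inverse (?a powr (3 / 2) * ?b powr (3 / 2))"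
      proof -
        have pos: "?a powr (3 / 2) * ?b powr (3 / 2) > 0" "?x ^ 3 > 0" using False by simp_all
        have "1 / u \<le> L * inverse q" if "q \<le> L * u" "q > 0" "u > 0" for u q L :: real
          using that by (simp add: field_simps)
        from this[OF * pos] show ?thesis .
      qed
      then show ?thesis
        by (simp only: p g_def powr_minus inverse_mult_distrib prod.case real_norm_def abs_divide
            abs_one power_abs abs_norm_cancel mult.assoc)
    qed (use K g_nonneg in \<open>auto simp: p\<close>)
  qed
  then show ?thesis by (rule abs_summable_summable)
qed

text \<open>The lattice points at v and v + w differ by the fixed number w1 \<tau> + w2, so the
  inverse cubes at both points dominate the difference.\<close>

lemma lattice_difference_summable:
  assumes "Im \<tau> > 0"
  shows "(\<lambda>v. norm (lattice_term \<tau> v - lattice_term \<tau> (v + w))) summable_on UNIV"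
proof -
  obtain w1 w2 where w: "w = (w1, w2)" by force
  let ?R = "\<lambda>(m, n). 1 / cmod (of_int m * \<tau> + of_int n) ^ 3"
  have R: "?R summable_on UNIV" by (rule lattice_cube_summable[OF assms])
  have "bij (\<lambda>v. v + w)" by (rule bij_betw_byWitness[where f' = "\<lambda>v. v - w"]) auto
  then have "(\<lambda>v. ?R (v + w)) summable_on UNIV"
    using R by (subst summable_on_reindex_bij_betw) auto
  then have "(\<lambda>v. cmod (of_int w1 * \<tau> + of_int w2) * (?R v + ?R (v + w))) summable_on UNIV"
    using R by (intro summable_on_cmult_right summable_on_add)
  then show ?thesis
  proof (rule Infinite_Sum.abs_summable_on_comparison_test')
    fix v :: "int \<times> int"
    obtain m n where v: "v = (m, n)" by force
    have "norm ((of_int m * \<tau> + of_int n) - (of_int (m + w1) * \<tau> + of_int (n + w2)))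
        = cmod (of_int w1 * \<tau> + of_int w2)"
      by (subst norm_minus_commute) (simp add: algebra_simps)
    then show "norm (lattice_term \<tau> v - lattice_term \<tau> (v + w))
        \<le> cmod (of_int w1 * \<tau> + of_int w2) * (?R v + ?R (v + w))"
      using lattice_term_difference_bound[of "of_int m * \<tau> + of_int n"
          "of_int (m + w1) * \<tau> + of_int (n + w2)"]
      unfolding v w lattice_term_def by simp
  qed
qed

section \<open>The Lipschitz formula\<close>

lemma sum_inverse_squares_int:
  assumes "Im z > 0"
  shows "((\<lambda>n. 1 / (z + of_int n) ^ 2) has_sum (of_real pi / sin (of_real pi * z)) ^ 2) UNIV"
proof -
  let ?f = "\<lambda>n::int. 1 / (z + of_int n) ^ 2"
  have z: "z \<notin> \<int>" using assms by (auto elim!: Ints_cases)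
  \<comment> \<open>These are the terms of row \<open>m = 1\<close> in the lattice spanned by z and
    1.\<close>
  have "(\<lambda>n. norm (?f n)) summable_on UNIV"
    using lattice_term_row_summable[OF assms, of 1] by (simp add: lattice_term_def)
  then have f: "?f summable_on UNIV" by (rule abs_summable_summable)
  \<comment> \<open>The ordered series for \<open>Polygamma 1\<close> supplies the value;
    unconditional summability is inherited from \<open>f\<close>.\<close>
  have half: "((\<lambda>n. ?f (g n)) has_sum Polygamma 1 u) UNIV"
    if inj: "inj g" and sq: "\<And>n. (z + of_int (g n)) ^ 2 = (u + of_nat n) ^ 2" and u: "u \<noteq> 0"
    for g :: "nat \<Rightarrow> int" and u
  proof -
    have "?f summable_on range g" by (rule summable_on_subset_banach[OF f]) simp
    then have s: "(\<lambda>n. ?f (g n)) summable_on UNIV"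
      using inj by (subst (asm) summable_on_reindex) (auto simp: o_def)
    have "(\<lambda>n. ?f (g n)) sums Polygamma 1 u"
    proof -
      have "(\<lambda>n. ?f (g n)) = (\<lambda>n. inverse ((u + of_nat n) ^ Suc 1))"
        unfolding sq by (simp add: divide_inverse numeral_2_eq_2)
      then show ?thesis using Polygamma_LIMSEQ[of u 1] u by simp
    qed
    then have "infsum (\<lambda>n. ?f (g n)) UNIV = Polygamma 1 u"
      using has_sum_imp_sums[OF has_sum_infsum[OF s]] sums_unique2 by blast
    then show ?thesis using has_sum_infsum[OF s] by simp
  qed
  have "((\<lambda>n. ?f (int n)) has_sum Polygamma 1 z) UNIV"
    using z by (intro half) (auto simp: inj_def)
  then have 1: "(?f has_sum Polygamma 1 z) (range int)"
    by (subst has_sum_reindex) (auto simp: o_def)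
  \<comment> \<open>The negative integers are -n - 1 with n \<ge> 0, and (z - n - 1)^2 = (1 - z +
    n)^2.\<close>
  have "((\<lambda>n. ?f (- int n - 1)) has_sum Polygamma 1 (1 - z)) UNIV"
    using z by (intro half) (auto simp: inj_def power2_eq_square algebra_simps)
  then have 2: "(?f has_sum Polygamma 1 (1 - z)) (range (\<lambda>n. - int n - 1))"
    by (subst has_sum_reindex) (auto simp: o_def inj_def)
  have "range int \<union> range (\<lambda>n. - int n - 1) = UNIV"
  proof -
    have "n \<in> range int \<union> range (\<lambda>n. - int n - 1)" for n
    proof (cases "n \<ge> 0")
      case True
      then have "n = int (nat n)" by simp
      then show ?thesis by blast
    next
      case False
      then have "n = - int (nat (- n - 1)) - 1" by simp
      then show ?thesis by blast
    qed
    then show ?thesis by blast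
  qed
  moreover have "range int \<inter> range (\<lambda>n. - int n - 1) = {}" by auto
  ultimately show ?thesis
    using has_sum_Un_disjoint[OF 1 2] Polygamma_1_reflection[OF z] by simp
qed

text \<open>With u = exp(\<i> \<pi> z) one has Q = u^2 and 2 \<i> u sin(\<pi> z) = Q - 1; squaring
  gives the identity.\<close>

lemma pi_over_sin_squared:
  assumes "Im z > 0"
  defines "Q \<equiv> exp (2 * of_real pi * \<i> * z)"
  shows "(of_real pi / sin (of_real pi * z)) ^ 2 = - 4 * of_real pi ^ 2 * (Q / (1 - Q) ^ 2)"
    and "norm Q < 1"
proof -
  show Q: "norm Q < 1" using assms by (simp add: Q_def norm_exp)
  define u where "u = exp (\<i> * (of_real pi * z))"
  have u: "u \<noteq> 0" by (simp add: u_def)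
  have Qu: "Q = u ^ 2" unfolding Q_def u_def by (subst exp_double[symmetric]) (simp add: mult_ac)
  define s where "s = sin (of_real pi * z)"
  have "s = (u - inverse u) / (2 * \<i>)"
    unfolding s_def u_def sin_exp_eq exp_minus ..
  then have "s * (2 * \<i>) = u - inverse u" unfolding eq_divide_eq by simp
  then have "s * (2 * \<i> * u) = (u - inverse u) * u" by (simp only: mult.assoc[symmetric])
  also have "\<dots> = Q - 1"
    using u by (simp add: Qu power2_eq_square left_diff_distrib)
  finally have "s * (2 * \<i> * u) = Q - 1" .
  then have "(s * (2 * \<i> * u)) ^ 2 = (1 - Q) ^ 2" by (simp only: power2_commute)
  then have sq: "s ^ 2 * (- 4 * Q) = (1 - Q) ^ 2" by (simp add: power_mult_distrib Qu)
  have "1 - Q \<noteq> 0" using Q by auto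
  then have "s \<noteq> 0" using sq by auto
  have "(of_real pi / s) ^ 2 = of_real pi ^ 2 * (- 4 * Q) / (s ^ 2 * (- 4 * Q))"
    using Qu u by (simp add: power_divide)
  also have "\<dots> = - 4 * of_real pi ^ 2 * (Q / (1 - Q) ^ 2)" unfolding sq by simp
  finally show "(of_real pi / sin (of_real pi * z)) ^ 2 = - 4 * of_real pi ^ 2 * (Q / (1 - Q) ^ 2)"
    unfolding s_def .
qed

text \<open>The differentiated geometric series, shifted by one index. At w = exp(2 \<pi> \<i> z)
  its value is the fraction in the closed form of the sum of inverse squares, which completes the
  Lipschitz formula.\<close>

lemma has_sum_nat_times_power:
  fixes w :: complex
  assumes "norm w < 1"
  shows "((\<lambda>d. of_nat d * w ^ d) has_sum w / (1 - w) ^ 2) {1..}"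
proof -
  have "summable (\<lambda>n. norm (of_nat (Suc n) * w ^ n))"
    using geometric_deriv_sums[of "norm w"] assms
    by (simp add: sums_iff norm_mult norm_power del: of_nat_Suc)
  then have "((\<lambda>n. of_nat (Suc n) * w ^ n) has_sum 1 / (1 - w) ^ 2) UNIV"
    by (rule norm_summable_imp_has_sum) (rule geometric_deriv_sums[OF assms])
  then have "((\<lambda>n. w * (of_nat (Suc n) * w ^ n)) has_sum w * (1 / (1 - w) ^ 2)) UNIV"
    by (rule has_sum_cmult_right)
  also have "?this \<longleftrightarrow> ?thesis"
    by (rule has_sum_reindex_bij_witness[where i = "\<lambda>d. d - 1" and j = Suc]) (auto simp: mult_ac)
  finally show ?thesis .
qed

section \<open>Lambert series\<close>

text \<open>For \<open>c\<close> constantly 1 the coefficient of w^n is the divisor sum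
  \<sigma>_1(n). A general \<open>c\<close> can encode congruence conditions on m and d.\<close>

definition lambert :: "(nat \<Rightarrow> nat \<Rightarrow> complex) \<Rightarrow> complex \<Rightarrow> complex" where
  "lambert c w = (\<Sum>\<^sub>\<infinity>(m, d)\<in>{1..} \<times> {1..}. of_nat d * c m d * w ^ (m * d))"

text \<open>For m, d \<ge> 1 one has m d \<ge> (m - 1) + (d - 1), so up to the factor C the terms
  are dominated by a geometric series in m times a differentiated one in d.\<close>

lemma lambert_summable:
  fixes c :: "nat \<Rightarrow> nat \<Rightarrow> complex"
  assumes c: "\<And>m d. norm (c m d) \<le> C" and w: "norm w < 1"
  shows "(\<lambda>(m, d). of_nat d * c m d * w ^ (m * d)) summable_on {1..} \<times> {1..}"
proof -
  define r where "r = norm w"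
  have r: "0 \<le> r" "r < 1" using w by (auto simp: r_def)
  have C: "C \<ge> 0" using c[of 0 0] norm_ge_zero order.trans by blast
  have "((\<lambda>n. r ^ n) has_sum 1 / (1 - r)) UNIV"
    using r by (intro norm_summable_imp_has_sum) (auto simp: geometric_sums)
  also have "?this \<longleftrightarrow> ((\<lambda>m. r ^ (m - 1)) has_sum 1 / (1 - r)) {1..}"
    by (rule has_sum_reindex_bij_witness[where i = "\<lambda>d. d - 1" and j = Suc]) auto
  finally have g: "((\<lambda>m. r ^ (m - 1)) has_sum 1 / (1 - r)) {1..}" .
  have "(\<lambda>n. real (Suc n) * r ^ n) sums (1 / (1 - r) ^ 2)"
    using r by (intro geometric_deriv_sums) auto
  then have "((\<lambda>n. real (Suc n) * r ^ n) has_sum 1 / (1 - r) ^ 2) UNIV"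
    using r by (intro norm_summable_imp_has_sum) (auto simp: sums_iff simp del: of_nat_Suc)
  also have "?this \<longleftrightarrow> ((\<lambda>d. real d * r ^ (d - 1)) has_sum 1 / (1 - r) ^ 2) {1..}"
    by (rule has_sum_reindex_bij_witness[where i = "\<lambda>d. d - 1" and j = Suc]) auto
  finally have h: "((\<lambda>d. real d * r ^ (d - 1)) has_sum 1 / (1 - r) ^ 2) {1..}" .
  have "(\<lambda>(m, d). r ^ (m - 1) * (real d * r ^ (d - 1))) summable_on {1..} \<times> {1..}"
  proof (rule summable_on_SigmaI)
    show "((\<lambda>d. case (m, d) of (m, d) \<Rightarrow> r ^ (m - 1) * (real d * r ^ (d - 1)))
        has_sum r ^ (m - 1) * (1 / (1 - r) ^ 2)) {1..}" for m
      using has_sum_cmult_right[OF h] by simp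
    show "(\<lambda>m. r ^ (m - 1) * (1 / (1 - r) ^ 2)) summable_on {1..}"
      using g by (intro summable_on_cmult_left) (rule has_sum_imp_summable)
  qed (use r in auto)
  then have "(\<lambda>p. C * (case p of (m, d) \<Rightarrow> r ^ (m - 1) * (real d * r ^ (d - 1)))) summable_on {1..} \<times> {1..}"
    by (rule summable_on_cmult_right)
  then have "(\<lambda>p. norm (case p of (m, d) \<Rightarrow> of_nat d * c m d * w ^ (m * d))) summable_on {1..} \<times> {1..}"
  proof (rule Infinite_Sum.abs_summable_on_comparison_test')
    fix p :: "nat \<times> nat" assume "p \<in> {1..} \<times> {1..}"
    then have "p = (Suc (fst p - 1), Suc (snd p - 1))" by (cases p) auto
    then obtain m d where p: "p = (Suc m, Suc d)" by blast
    have "r ^ (Suc m * Suc d) \<le> r ^ (m + d)" using r by (intro power_decreasing) auto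
    then have "norm (c (Suc m) (Suc d)) * r ^ (Suc m * Suc d) \<le> C * r ^ (m + d)"
      using C r by (intro mult_mono c) auto
    then have "real (Suc d) * (norm (c (Suc m) (Suc d)) * r ^ (Suc m * Suc d)) \<le> real (Suc d) * (C * r ^ (m + d))"
      by (rule mult_left_mono) simp
    then show "norm (case p of (m, d) \<Rightarrow> of_nat d * c m d * w ^ (m * d))
        \<le> C * (case p of (m, d) \<Rightarrow> r ^ (m - 1) * (real d * r ^ (d - 1)))"
      by (simp only: p prod.case norm_mult norm_power norm_of_nat r_def diff_Suc_1 power_add mult_ac)
  qed
  then show ?thesis by (rule abs_summable_summable)
qed

text \<open>Absolute convergence permits grouping by n = m d. The fibres are finite, and the one
  over 0 is empty.\<close>

lemma lambert_power_series:
  assumes c: "\<And>m d. norm (c m d) \<le> C" and w: "norm w < 1"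
  shows "(\<lambda>n. (\<Sum>(m, d)\<in>{p \<in> {1..} \<times> {1..}. fst p * snd p = n}. of_nat d * c m d) * w ^ n)
           sums lambert c w"
proof -
  let ?P = "\<lambda>n. {p \<in> {1..} \<times> {1..}. fst p * snd p = (n::nat)}"
  let ?f = "\<lambda>(m, d). of_nat d * c m d * w ^ (m * d)"
  have fin: "finite (?P n)" for n
  proof (rule finite_subset)
    show "?P n \<subseteq> {..n} \<times> {..n}" by (auto simp: Suc_le_eq)
  qed simp
  have "(?f has_sum lambert c w) ({1..} \<times> {1..})"
    unfolding lambert_def by (rule has_sum_infsum[OF lambert_summable[OF c w]])
  also have "?this \<longleftrightarrow> ((\<lambda>(n, p). ?f p) has_sum lambert c w) (Sigma UNIV ?P)"
    by (rule has_sum_reindex_bij_witness[where i = snd and j = "\<lambda>p. (fst p * snd p, p)"]) auto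
  finally have "((\<lambda>(n, p). ?f p) has_sum lambert c w) (Sigma UNIV ?P)" .
  then have "((\<lambda>n. sum ?f (?P n)) has_sum lambert c w) UNIV"
  proof (rule has_sum_Sigma')
    show "((\<lambda>p. case (n, p) of (n, p) \<Rightarrow> ?f p) has_sum sum ?f (?P n)) (?P n)" for n
      using has_sum_finite[OF fin[of n], of ?f] by (simp only: prod.case)
  qed
  then have "(\<lambda>n. sum ?f (?P n)) sums lambert c w" by (rule has_sum_imp_sums)
  moreover have "sum ?f (?P n) = (\<Sum>(m, d)\<in>?P n. of_nat d * c m d) * w ^ n" for n
    unfolding sum_distrib_right by (rule sum.cong) auto
  ultimately show ?thesis by simp
qed

section \<open>Weighted Eisenstein series of weight two\<close>

definition zeta8 :: complex where
  "zeta8 = exp (2 * of_real pi * \<i> / 8)"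

text \<open>The finite Fourier transform in the second variable, for weights of period 8. It arises
  when a row is split into residue classes modulo 8 and each class is expanded by the Lipschitz
  formula.\<close>

definition row_dft :: "(int \<times> int \<Rightarrow> complex) \<Rightarrow> nat \<Rightarrow> nat \<Rightarrow> complex" where
  "row_dft \<eta> m d = (\<Sum>s<8. \<eta> (int m, int s) * zeta8 ^ (s * d))"

definition lattice_row :: "(int \<times> int \<Rightarrow> complex) \<Rightarrow> complex \<Rightarrow> int \<Rightarrow> complex" where
  "lattice_row \<eta> \<tau> m = (\<Sum>\<^sub>\<infinity>n. \<eta> (m, n) * lattice_term \<tau> (m, n))"

text \<open>The iterated sum is essential: the double sum over \<open>(m, n)\<close> is not absolutely convergent.\<close>

definition eisenstein :: "(int \<times> int \<Rightarrow> complex) \<Rightarrow> complex \<Rightarrow> complex" where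
  "eisenstein \<eta> \<tau> = (\<Sum>\<^sub>\<infinity>m. lattice_row \<eta> \<tau> m)"

lemma has_sum_finite_sum:
  fixes f :: "'i \<Rightarrow> 'a \<Rightarrow> complex"
  assumes "\<And>i. i \<in> I \<Longrightarrow> (f i has_sum s i) A"
  shows "((\<lambda>x. \<Sum>i\<in>I. f i x) has_sum (\<Sum>i\<in>I. s i)) A"
  using assms
proof (induction I rule: infinite_finite_induct)
  case (insert i I)
  then have "((\<lambda>x. f i x + (\<Sum>i\<in>I. f i x)) has_sum (s i + (\<Sum>i\<in>I. s i))) A"
    by (intro has_sum_add) auto
  then show ?case using insert.hyps by simp
qed simp_all

lemma norm_zeta8: "norm zeta8 = 1"
  by (simp add: zeta8_def)

lemma row_dft_bound:
  assumes "\<forall>v. norm (\<eta> v) \<le> 1"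
  shows "norm (row_dft \<eta> m d) \<le> 8"
proof -
  have "norm (row_dft \<eta> m d) \<le> (\<Sum>s<8::nat. 1)"
    unfolding row_dft_def
    by (rule order.trans[OF norm_sum sum_mono]) (simp add: norm_mult norm_power norm_zeta8 assms)
  then show ?thesis by simp
qed

lemma lattice_row_has_sum:
  assumes "Im \<tau> > 0" and "\<forall>v. norm (\<eta> v) \<le> 1"
  shows "((\<lambda>n. \<eta> (m, n) * lattice_term \<tau> (m, n)) has_sum lattice_row \<eta> \<tau> m) UNIV"
proof -
  have "(\<lambda>n. norm (\<eta> (m, n) * lattice_term \<tau> (m, n))) summable_on UNIV"
    using lattice_term_row_summable[OF assms(1), of m]
    by (rule Infinite_Sum.abs_summable_on_comparison_test')
      (simp add: norm_mult assms mult_left_le_one_le)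
  then show ?thesis
    unfolding lattice_row_def by (rule has_sum_infsum[OF abs_summable_summable])
qed

text \<open>Lattice terms are invariant under v to -v, so rows with negative m reduce to rows with
  positive m, whose points lie in the upper half plane.\<close>

lemma lattice_row_negative:
  "lattice_row \<eta> \<tau> (- m) = lattice_row (\<lambda>v. \<eta> (- v)) \<tau> m"
  unfolding lattice_row_def
proof (rule infsum_reindex_bij_witness[where i = uminus and j = uminus])
  fix n :: int
  have "(of_int m * \<tau> + of_int (- n)) ^ 2 = (- (of_int m * \<tau> + of_int (- n))) ^ 2"
    by (simp only: power2_minus)
  then show "\<eta> (- (m, - n)) * lattice_term \<tau> (m, - n) = \<eta> (- m, n) * lattice_term \<tau> (- m, n)"
    by (simp add: lattice_term_def)
qed auto

text \<open>On the class n = s + 8 j one has m \<tau> + n = 8 (z_s + j) with z_s = (m \<tau> + s)/8,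
  where Im z_s > 0 because m \<ge> 1. In the Lipschitz formula at z_s, exp(2 \<pi> \<i> z_s) is
  \<open>zeta8 ^ s\<close> times the m-th power of q^(1/8); collecting the eight classes gives
  \<open>row_dft\<close>.\<close>

lemma lattice_row_eq:
  assumes \<tau>: "Im \<tau> > 0" and bounded: "\<forall>v. norm (\<eta> v) \<le> 1"
    and periodic: "\<forall>m n. \<eta> (m, n + 8) = \<eta> (m, n)" and m: "m \<ge> 1"
  shows "((\<lambda>d. of_nat d * row_dft \<eta> m d * q_power (1 / 8) \<tau> ^ (m * d))
           has_sum (- 16 / of_real pi ^ 2 * lattice_row \<eta> \<tau> (int m))) {1..}"
proof -
  define z where "z s = (of_nat m * \<tau> + of_nat s) / 8" for s :: nat
  define Q where "Q s = exp (2 * of_real pi * \<i> * z s)" for s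
  have z: "Im (z s) > 0" for s using \<tau> m by (simp add: z_def)
  have Q: "Q s = zeta8 ^ s * q_power (1 / 8) \<tau> ^ m" for s
  proof -
    have "zeta8 ^ s * q_power (1 / 8) \<tau> ^ m
        = exp (of_nat s * (2 * of_real pi * \<i> / 8) + of_nat m * (2 * of_real pi * \<i> * of_rat (1 / 8) * \<tau>))"
      by (simp only: zeta8_def q_power_def exp_of_nat_mult exp_add)
    also have "of_nat s * (2 * of_real pi * \<i> / 8) + of_nat m * (2 * of_real pi * \<i> * of_rat (1 / 8) * \<tau>)
        = 2 * of_real pi * \<i> * z s"
      by (simp add: z_def of_rat_divide algebra_simps add_divide_distrib)
    finally show ?thesis by (simp add: Q_def)
  qed
  have per: "\<eta> (a, b + 8 * j) = \<eta> (a, b)" for a b j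
  proof -
    have nat: "\<eta> (a, b + 8 * int k) = \<eta> (a, b)" for b k
    proof (induction k)
      case (Suc k)
      have "b + 8 * int (Suc k) = (b + 8 * int k) + 8" by simp
      then show ?case using periodic Suc by (simp only:)
    qed simp
    show ?thesis
      using nat[of b "nat j"] nat[of "b + 8 * j" "nat (- j)"] by (cases "j \<ge> 0") auto
  qed
  \<comment> \<open>The factor -\<pi>^2 / 16 is -4 \<pi>^2 / 64, with 64 coming from the square of 8
    (z_s + j).\<close>
  have cls: "((\<lambda>n. \<eta> (int m, n) * lattice_term \<tau> (int m, n)) has_sum
      \<eta> (int m, int s) * (- (of_real pi ^ 2 / 16) * (Q s / (1 - Q s) ^ 2))) (range (\<lambda>j. int s + 8 * j))" for s
  proof -
    have "((\<lambda>j. \<eta> (int m, int s) / 64 * (1 / (z s + of_int j) ^ 2)) has_sum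
        \<eta> (int m, int s) / 64 * (- 4 * of_real pi ^ 2 * (Q s / (1 - Q s) ^ 2))) UNIV"
      using sum_inverse_squares_int[OF z[of s]] unfolding pi_over_sin_squared(1)[OF z[of s]] Q_def
      by (rule has_sum_cmult_right)
    also have "(\<lambda>j. \<eta> (int m, int s) / 64 * (1 / (z s + of_int j) ^ 2))
        = (\<lambda>j. \<eta> (int m, int s + 8 * j) * lattice_term \<tau> (int m, int s + 8 * j))"
    proof
      fix j
      have "of_int (int m) * \<tau> + of_int (int s + 8 * j) = 8 * (z s + of_int j)"
        by (simp add: z_def)
      then have "lattice_term \<tau> (int m, int s + 8 * j) = 1 / (8 * (z s + of_int j)) ^ 2"
        by (simp only: lattice_term_def prod.case)
      then show "\<eta> (int m, int s) / 64 * (1 / (z s + of_int j) ^ 2)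
          = \<eta> (int m, int s + 8 * j) * lattice_term \<tau> (int m, int s + 8 * j)"
        by (simp only: per power_mult_distrib) simp
    qed
    finally show ?thesis by (subst has_sum_reindex) (auto simp: inj_on_def o_def mult_ac)
  qed
  have "((\<lambda>n. \<eta> (int m, n) * lattice_term \<tau> (int m, n)) has_sum
      (\<Sum>s<8. \<eta> (int m, int s) * (- (of_real pi ^ 2 / 16) * (Q s / (1 - Q s) ^ 2))))
      (\<Union>s\<in>{..<8}. range (\<lambda>j. int s + 8 * j))"
  proof (rule sum_has_sum)
    show "range (\<lambda>j. int s + 8 * j) \<inter> range (\<lambda>j. int s' + 8 * j) = {}"
      if "s \<in> {..<8}" "s' \<in> {..<8}" "s \<noteq> s'" for s s'
    proof -
      have "(int s + 8 * j) mod 8 = int s" "(int s' + 8 * j) mod 8 = int s'" for j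
        using that by simp_all
      then show ?thesis using that(3) by (auto dest: arg_cong[where f = "\<lambda>x. x mod 8"])
    qed
  qed (use cls in auto)
  also have "(\<Union>s\<in>{..<8}. range (\<lambda>j. int s + 8 * j)) = (UNIV :: int set)"
  proof -
    have "n \<in> (\<Union>s\<in>{..<8}. range (\<lambda>j. int s + 8 * j))" for n
    proof
      show "nat (n mod 8) \<in> {..<8}" by (auto simp: nat_less_iff)
      have "n = int (nat (n mod 8)) + 8 * (n div 8)" by simp
      then show "n \<in> range (\<lambda>j. int (nat (n mod 8)) + 8 * j)" by blast
    qed
    then show ?thesis by blast
  qed
  finally have row: "lattice_row \<eta> \<tau> (int m)
      = (\<Sum>s<8. \<eta> (int m, int s) * (- (of_real pi ^ 2 / 16) * (Q s / (1 - Q s) ^ 2)))"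
    using lattice_row_has_sum[OF \<tau> bounded, of "int m"] has_sum_unique by blast
  have "((\<lambda>d. \<Sum>s<8. \<eta> (int m, int s) * (of_nat d * Q s ^ d)) has_sum
      (\<Sum>s<8. \<eta> (int m, int s) * (Q s / (1 - Q s) ^ 2))) {1..}"
    using pi_over_sin_squared(2)[OF z]
    by (intro has_sum_finite_sum has_sum_cmult_right has_sum_nat_times_power) (simp add: Q_def)
  also have "(\<lambda>d. \<Sum>s<8. \<eta> (int m, int s) * (of_nat d * Q s ^ d))
      = (\<lambda>d. of_nat d * row_dft \<eta> m d * q_power (1 / 8) \<tau> ^ (m * d))"
    unfolding row_dft_def sum_distrib_left sum_distrib_right Q
    by (intro ext sum.cong refl) (simp add: power_mult_distrib mult_ac flip: power_mult)
  also have "(\<Sum>s<8. \<eta> (int m, int s) * (Q s / (1 - Q s) ^ 2)) = - 16 / of_real pi ^ 2 * lattice_row \<eta> \<tau> (int m)"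
    unfolding row sum_distrib_left by (intro sum.cong refl) simp
  finally show ?thesis .
qed

text \<open>Boundedness and periodicity yield the Lambert expansion; the sign change under w allows
  terms to be paired for absolute convergence. The vector w is a parameter because
  \<open>SL2Z\<close> moves it.\<close>

definition alternating_weight :: "(int \<times> int \<Rightarrow> complex) \<Rightarrow> int \<times> int \<Rightarrow> bool" where
  "alternating_weight \<eta> w \<longleftrightarrow>
     (\<forall>v. norm (\<eta> v) \<le> 1) \<and> (\<forall>m n i j. \<eta> (m + 8 * i, n + 8 * j) = \<eta> (m, n)) \<and>
     (\<forall>v. \<eta> (v + w) = - \<eta> v)"

lemma alternating_weightD:
  assumes "alternating_weight \<eta> w"
  shows "\<forall>v. norm (\<eta> v) \<le> 1" "\<eta> (m + 8 * i, n + 8 * j) = \<eta> (m, n)" "\<eta> (v + w) = - \<eta> v"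
  using assms unfolding alternating_weight_def by blast+

lemma norm_q_power_eighth_less_1:
  assumes "Im \<tau> > 0"
  shows "norm (q_power (1 / 8) \<tau>) < 1"
  using assms by (simp add: q_power_def norm_exp of_rat_divide)

text \<open>The rows with m > 0 give the Lambert series of \<eta>, those with m < 0 that of the
  reflected weight, and row 0 gives the constant.\<close>

lemma lattice_rows_has_sum:
  assumes \<tau>: "Im \<tau> > 0" and \<eta>: "alternating_weight \<eta> w"
  defines "Q \<equiv> q_power (1 / 8) \<tau>"
  shows "(lattice_row \<eta> \<tau> has_sum (\<Sum>\<^sub>\<infinity>n. \<eta> (0, n) / of_int n ^ 2)
           - of_real pi ^ 2 / 16 * (lambert (row_dft \<eta>) Q + lambert (row_dft (\<lambda>v. \<eta> (- v))) Q)) UNIV"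
proof -
  let ?\<eta>' = "\<lambda>v. \<eta> (- v)"
  note bounded = alternating_weightD(1)[OF \<eta>]
  have bounded': "\<forall>v. norm (?\<eta>' v) \<le> 1" using bounded by simp
  have per: "\<forall>m n. \<eta> (m, n + 8) = \<eta> (m, n)"
    using alternating_weightD(2)[OF \<eta>, where i = 0 and j = 1] by simp
  have per': "\<forall>m n. \<eta> (- (m, n + 8)) = \<eta> (- (m, n))"
    using alternating_weightD(2)[OF \<eta>, where i = 0 and j = "- 1"] by simp
  have half: "((\<lambda>m. lattice_row \<theta> \<tau> (int m)) has_sum - (of_real pi ^ 2 / 16) * lambert (row_dft \<theta>) Q) {1..}"
    if b: "\<forall>v. norm (\<theta> v) \<le> 1" and p: "\<forall>m n. \<theta> (m, n + 8) = \<theta> (m, n)" for \<theta>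
  proof -
    have "((\<lambda>(m, d). of_nat d * row_dft \<theta> m d * Q ^ (m * d)) has_sum lambert (row_dft \<theta>) Q) ({1..} \<times> {1..})"
      unfolding lambert_def Q_def using row_dft_bound[OF b] norm_q_power_eighth_less_1[OF \<tau>]
      by (intro has_sum_infsum lambert_summable) auto
    \<comment> \<open>Summing the double series over d first collects each row.\<close>
    then have "((\<lambda>m. - 16 / of_real pi ^ 2 * lattice_row \<theta> \<tau> (int m)) has_sum lambert (row_dft \<theta>) Q) {1..}"
      by (rule has_sum_Sigma') (use lattice_row_eq[OF \<tau> b p] in \<open>simp add: Q_def\<close>)
    from has_sum_cmult_right[OF this, of "- (of_real pi ^ 2 / 16)"] show ?thesis by simp
  qed
  have 1: "(lattice_row \<eta> \<tau> has_sum - (of_real pi ^ 2 / 16) * lambert (row_dft \<eta>) Q) (int ` {1..})"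
    using half[OF bounded per] by (subst has_sum_reindex) (auto simp: o_def)
  have "((\<lambda>m. lattice_row \<eta> \<tau> (- int m)) has_sum - (of_real pi ^ 2 / 16) * lambert (row_dft ?\<eta>') Q) {1..}"
    unfolding lattice_row_negative using half[OF bounded' per'] .
  then have 2: "(lattice_row \<eta> \<tau> has_sum - (of_real pi ^ 2 / 16) * lambert (row_dft ?\<eta>') Q) ((\<lambda>m. - int m) ` {1..})"
    by (subst has_sum_reindex) (auto simp: o_def inj_on_def)
  \<comment> \<open>Row 0 is independent of \<tau>; its entry at n = 0 vanishes by 1/0 = 0.\<close>
  have 0: "(lattice_row \<eta> \<tau> has_sum (\<Sum>\<^sub>\<infinity>n. \<eta> (0, n) / of_int n ^ 2)) {0}"
    by (simp add: lattice_row_def lattice_term_def has_sum_finiteI)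
  have "((int ` {1..}) \<union> ((\<lambda>m. - int m) ` {1..})) \<union> {0} = (UNIV :: int set)"
  proof -
    have "n \<in> (int ` {1..}) \<union> ((\<lambda>m. - int m) ` {1..}) \<union> {0}" for n :: int
    proof -
      consider "n = 0" | "n > 0" | "n < 0" by linarith
      then show ?thesis
      proof cases
        case 2
        then have "n = int (nat n)" "nat n \<in> {1..}" by auto
        then show ?thesis by blast
      next
        case 3
        then have "n = - int (nat (- n))" "nat (- n) \<in> {1..}" by auto
        then show ?thesis by blast
      qed simp
    qed
    then show ?thesis by blast
  qed
  moreover have "(int ` {1..}) \<inter> ((\<lambda>m. - int m) ` {1..}) = {}"
      "((int ` {1..}) \<union> ((\<lambda>m. - int m) ` {1..})) \<inter> {0} = {}"
    by auto
  ultimately show ?thesis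
    using has_sum_Un_disjoint[OF has_sum_Un_disjoint[OF 1 2] 0]
    by (simp add: algebra_simps add_divide_distrib)
qed

lemma eisenstein_eq_lambert:
  assumes "Im \<tau> > 0" "alternating_weight \<eta> w"
  shows "eisenstein \<eta> \<tau> = (\<Sum>\<^sub>\<infinity>n. \<eta> (0, n) / of_int n ^ 2)
           - of_real pi ^ 2 / 16 * (lambert (row_dft \<eta>) (q_power (1 / 8) \<tau>)
               + lambert (row_dft (\<lambda>v. \<eta> (- v))) (q_power (1 / 8) \<tau>))"
  unfolding eisenstein_def by (rule infsumI[OF lattice_rows_has_sum[OF assms]])

section \<open>Expansion in powers of q^(1/8) and holomorphy\<close>

lemma q_power_nat_divide: "q_power (of_nat n / of_nat N) \<tau> = q_power (1 / of_nat N) \<tau> ^ n"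
  unfolding q_power_def exp_of_nat_mult[symmetric]
  by (simp add: of_rat_divide mult_ac)

lemma eisenstein_q_expansion:
  assumes "alternating_weight \<eta> w"
  shows "\<exists>a. \<forall>\<tau>\<in>upper_half_plane.
           (\<lambda>n. a n * q_power (of_nat n / of_nat 8) \<tau>) sums eisenstein \<eta> \<tau>"
proof -
  note bounded = alternating_weightD(1)[OF assms]
  define b where "b c n = (\<Sum>(m, d)\<in>{p \<in> {1..} \<times> {1..}. fst p * snd p = n}. of_nat d * c m d)"
    for c :: "nat \<Rightarrow> nat \<Rightarrow> complex" and n :: nat
  define a where "a n = (if n = 0 then (\<Sum>\<^sub>\<infinity>n. \<eta> (0, n) / of_int n ^ 2) else 0)
      - of_real pi ^ 2 / 16 * (b (row_dft \<eta>) n + b (row_dft (\<lambda>v. \<eta> (- v))) n)" for n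
  have "(\<lambda>n. a n * q_power (of_nat n / of_nat 8) \<tau>) sums eisenstein \<eta> \<tau>" if "\<tau> \<in> upper_half_plane" for \<tau>
  proof -
    have \<tau>: "Im \<tau> > 0" using that by (simp add: upper_half_plane_def)
    let ?Q = "q_power (1 / 8) \<tau>"
    have Q: "norm ?Q < 1" by (rule norm_q_power_eighth_less_1[OF \<tau>])
    have *: "(\<lambda>n. b (row_dft \<theta>) n * ?Q ^ n) sums lambert (row_dft \<theta>) ?Q"
      if "\<forall>v. norm (\<theta> v) \<le> 1" for \<theta>
      unfolding b_def by (rule lambert_power_series[OF _ Q]) (rule row_dft_bound[OF that])
    have "(\<lambda>n. (if n = 0 then (\<Sum>\<^sub>\<infinity>n. \<eta> (0, n) / of_int n ^ 2) else 0)
        - of_real pi ^ 2 / 16 * (b (row_dft \<eta>) n * ?Q ^ n + b (row_dft (\<lambda>v. \<eta> (- v))) n * ?Q ^ n))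
        sums eisenstein \<eta> \<tau>"
      unfolding eisenstein_eq_lambert[OF \<tau> assms]
      using sums_single[of 0 "\<lambda>_. \<Sum>\<^sub>\<infinity>n. \<eta> (0, n) / of_int n ^ 2"] bounded
      by (intro sums_diff sums_mult sums_add *) auto
    moreover have "a n * q_power (of_nat n / of_nat 8) \<tau>
        = (if n = 0 then (\<Sum>\<^sub>\<infinity>n. \<eta> (0, n) / of_int n ^ 2) else 0)
        - of_real pi ^ 2 / 16 * (b (row_dft \<eta>) n * ?Q ^ n + b (row_dft (\<lambda>v. \<eta> (- v))) n * ?Q ^ n)" for n
      using q_power_nat_divide[of n 8 \<tau>] by (simp add: a_def algebra_simps)
    ultimately show ?thesis by simp
  qed
  then show ?thesis by blast
qed

lemma lambert_holomorphic:
  assumes "\<And>m d. norm (c m d) \<le> C"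
  shows "lambert c holomorphic_on ball 0 1"
  by (rule power_series_holomorphic) (use lambert_power_series[of c, OF assms] in auto)

text \<open>Read off from the Lambert form: up to a constant, a sum of power series on the unit disc
  composed with q^(1/8).\<close>

lemma eisenstein_holomorphic:
  assumes "alternating_weight \<eta> w"
  shows "eisenstein \<eta> holomorphic_on upper_half_plane"
proof -
  have hol: "(\<lambda>\<tau>. lambert (row_dft \<theta>) (q_power (1 / 8) \<tau>)) holomorphic_on upper_half_plane"
    if "\<forall>v. norm (\<theta> v) \<le> 1" for \<theta>
  proof -
    have "lambert (row_dft \<theta>) holomorphic_on ball 0 1"
      by (rule lambert_holomorphic) (rule row_dft_bound[OF that])
    moreover have "q_power (1 / 8) holomorphic_on upper_half_plane"
      unfolding q_power_def by (intro holomorphic_intros)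
    moreover have "q_power (1 / 8) ` upper_half_plane \<subseteq> ball 0 1"
      using norm_q_power_eighth_less_1 by (auto simp: upper_half_plane_def)
    ultimately show ?thesis
      using holomorphic_on_compose_gen[of "q_power (1 / 8)" _ "lambert (row_dft \<theta>)"] by (simp add: o_def)
  qed
  have "(\<lambda>\<tau>. (\<Sum>\<^sub>\<infinity>n. \<eta> (0, n) / of_int n ^ 2)
           - of_real pi ^ 2 / 16 * (lambert (row_dft \<eta>) (q_power (1 / 8) \<tau>)
               + lambert (row_dft (\<lambda>v. \<eta> (- v))) (q_power (1 / 8) \<tau>))) holomorphic_on upper_half_plane"
    using alternating_weightD(1)[OF assms] by (intro holomorphic_intros hol) auto
  then show ?thesis
    by (rule holomorphic_transform) (simp add: eisenstein_eq_lambert[OF _ assms] upper_half_plane_def)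
qed

text \<open>Combining the terms at \<open>v\<close> and \<open>v + w\<close> makes the double sum absolutely convergent, since their
  weights are opposite; hence the order of summation no longer matters.\<close>

lemma eisenstein_telescoped:
  assumes \<tau>: "Im \<tau> > 0" and \<eta>: "alternating_weight \<eta> w"
  shows "((\<lambda>v. \<eta> v * (lattice_term \<tau> v - lattice_term \<tau> (v + w))) has_sum 2 * eisenstein \<eta> \<tau>) UNIV"
proof -
  obtain w1 w2 where w: "w = (w1, w2)" by force
  note bounded = alternating_weightD(1)[OF \<eta>]
  note alt = alternating_weightD(3)[OF \<eta>]
  let ?f = "\<lambda>v. \<eta> v * (lattice_term \<tau> v - lattice_term \<tau> (v + w))"
  have "(\<lambda>v. norm (?f v)) summable_on UNIV"
    using lattice_difference_summable[OF \<tau>, of w]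
    by (rule Infinite_Sum.abs_summable_on_comparison_test')
      (simp add: norm_mult bounded mult_left_le_one_le)
  then have f: "(?f has_sum infsum ?f UNIV) (UNIV \<times> UNIV)"
    using has_sum_infsum[OF abs_summable_summable] by simp
  \<comment> \<open>Since \<open>- \<eta> v = \<eta> (v + w)\<close>, the subtracted part is the
    weighted term at v + w, and these sum to row \<open>m + w1\<close>.\<close>
  have inner: "((\<lambda>n. ?f (m, n)) has_sum lattice_row \<eta> \<tau> m + lattice_row \<eta> \<tau> (m + w1)) UNIV" for m
  proof -
    have bij: "bij (\<lambda>n. n + w2)" by (rule bij_betw_byWitness[where f' = "\<lambda>n. n - w2"]) auto
    have "((\<lambda>n. \<eta> (m + w1, n + w2) * lattice_term \<tau> (m + w1, n + w2)) has_sum lattice_row \<eta> \<tau> (m + w1)) UNIV"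
      using lattice_row_has_sum[OF \<tau> bounded, of "m + w1"]
        has_sum_reindex_bij_betw[OF bij, of "\<lambda>n. \<eta> (m + w1, n) * lattice_term \<tau> (m + w1, n)"] by simp
    from has_sum_add[OF lattice_row_has_sum[OF \<tau> bounded, of m] this] show ?thesis
      using alt[of "(m, _)"] by (simp add: w algebra_simps)
  qed
  have rows: "(lattice_row \<eta> \<tau> has_sum eisenstein \<eta> \<tau>) UNIV"
    unfolding eisenstein_def by (rule has_sum_infsum[OF has_sum_imp_summable[OF lattice_rows_has_sum[OF assms]]])
  have bij: "bij (\<lambda>m. m + w1)" by (rule bij_betw_byWitness[where f' = "\<lambda>n. n - w1"]) auto
  have "((\<lambda>m. lattice_row \<eta> \<tau> (m + w1)) has_sum eisenstein \<eta> \<tau>) UNIV"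
    using rows by (simp only: has_sum_reindex_bij_betw[OF bij])
  then have "((\<lambda>m. lattice_row \<eta> \<tau> m + lattice_row \<eta> \<tau> (m + w1)) has_sum 2 * eisenstein \<eta> \<tau>) UNIV"
    using has_sum_add[OF rows, of _ "eisenstein \<eta> \<tau>"] by simp
  \<comment> \<open>Summing the absolutely convergent double series by rows gives the same row sums,
    which identifies its value.\<close>
  moreover have "((\<lambda>m. lattice_row \<eta> \<tau> m + lattice_row \<eta> \<tau> (m + w1)) has_sum infsum ?f UNIV) UNIV"
    using has_sum_Sigma'[OF f inner] .
  ultimately show ?thesis using f has_sum_unique by fastforce
qed

section \<open>The action of SL(2,Z)\<close>

lemma Im_moebius_pos:
  fixes a b c d :: int
  assumes det: "a * d - b * c = 1" and \<tau>: "Im \<tau> > 0"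
  shows "of_int c * \<tau> + of_int d \<noteq> 0"
    and "Im ((of_int a * \<tau> + of_int b) / (of_int c * \<tau> + of_int d)) > 0"
proof -
  have "c \<noteq> 0 \<or> d \<noteq> 0" using det by auto
  then show nz: "of_int c * \<tau> + of_int d \<noteq> 0"
    using \<tau> by (auto simp: complex_eq_iff)
  let ?z = "of_int a * \<tau> + of_int b" and ?w = "of_int c * \<tau> + of_int d"
  have "Im ?z * Re ?w - Re ?z * Im ?w = real_of_int (a * d - b * c) * Im \<tau>"
    by (simp add: algebra_simps)
  also have "\<dots> > 0" unfolding det using \<tau> by simp
  finally have "(Im ?z * Re ?w - Re ?z * Im ?w) / ((Re ?w) ^ 2 + (Im ?w) ^ 2) > 0"
    using nz by (intro divide_pos_pos) (auto simp: complex_eq_iff sum_power2_gt_zero_iff)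
  then show "Im (?z / ?w) > 0" by (simp only: Im_divide)
qed

text \<open>Multiplied by c \<tau> + d, the lattice point of the transformed argument at (m, n)
  becomes the lattice point of \<tau> at (m a + n c, m b + n d), so only the weight changes. The
  reindexing mixes rows and is made in the absolutely convergent paired sum; hence no correction
  term as for E_2 appears.\<close>

lemma eisenstein_moebius:
  fixes a b c d :: int
  assumes det: "a * d - b * c = 1" and \<tau>: "Im \<tau> > 0" and \<eta>: "alternating_weight \<eta> w"
  defines "\<eta>' \<equiv> \<lambda>(m, n). \<eta> (m * d - n * c, n * a - m * b)"
  shows "alternating_weight \<eta>' (fst w * a + snd w * c, fst w * b + snd w * d)"
    and "eisenstein \<eta> ((of_int a * \<tau> + of_int b) / (of_int c * \<tau> + of_int d))
           = (of_int c * \<tau> + of_int d) ^ 2 * eisenstein \<eta>' \<tau>"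
proof -
  \<comment> \<open>\<open>act\<close> multiplies row vectors by the matrix from the right, and
    \<open>pull\<close> does so with its inverse.\<close>
  define act where "act = (\<lambda>(m, n). (m * a + n * c, m * b + n * d))"
  define pull where "pull = (\<lambda>(m, n). (m * d - n * c, n * a - m * b))"
  have act_pull: "act (pull v) = v" and pull_act: "pull (act v) = v" for v
  proof -
    obtain m n where v: "v = (m, n)" by force
    have "act (pull v) = (m * (a * d - b * c), n * (a * d - b * c))"
      by (simp add: v act_def pull_def algebra_simps)
    then show "act (pull v) = v" by (simp add: v det)
    have "pull (act v) = (m * (a * d - b * c), n * (a * d - b * c))"
      by (simp add: v act_def pull_def algebra_simps)
    then show "pull (act v) = v" by (simp add: v det)
  qed
  have \<eta>'_pull: "\<eta>' v = \<eta> (pull v)" for v by (auto simp: \<eta>'_def pull_def split: prod.splits)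
  have act_add: "act (u + v) = act u + act v" for u v
    by (auto simp: act_def algebra_simps split: prod.splits)
  have pull_add: "pull (u + v) = pull u + pull v" for u v
    by (auto simp: pull_def algebra_simps split: prod.splits)
  have wA: "(fst w * a + snd w * c, fst w * b + snd w * d) = act w" by (simp add: act_def case_prod_beta)
  show alt': "alternating_weight \<eta>' (fst w * a + snd w * c, fst w * b + snd w * d)"
    unfolding wA alternating_weight_def
  proof (intro conjI allI)
    show "norm (\<eta>' v) \<le> 1" for v unfolding \<eta>'_pull using alternating_weightD(1)[OF \<eta>] by blast
    show "\<eta>' (v + act w) = - \<eta>' v" for v
      using alternating_weightD(3)[OF \<eta>] by (simp add: \<eta>'_pull pull_add pull_act)
    fix m n i j
    \<comment> \<open>An integral matrix preserves the sublattice of vectors divisible by 8, so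
      periodicity survives for all of SL(2,Z).\<close>
    have "pull (m + 8 * i, n + 8 * j) = (m * d - n * c + 8 * (i * d - j * c), n * a - m * b + 8 * (j * a - i * b))"
      by (simp add: pull_def algebra_simps)
    moreover have "pull (m, n) = (m * d - n * c, n * a - m * b)" by (simp add: pull_def)
    ultimately show "\<eta>' (m + 8 * i, n + 8 * j) = \<eta>' (m, n)"
      by (simp only: \<eta>'_pull alternating_weightD(2)[OF \<eta>])
  qed
  define \<tau>' where "\<tau>' = (of_int a * \<tau> + of_int b) / (of_int c * \<tau> + of_int d)"
  let ?j = "of_int c * \<tau> + of_int d"
  have j: "?j \<noteq> 0" and \<tau>': "Im \<tau>' > 0" using Im_moebius_pos[OF det \<tau>] by (simp_all add: \<tau>'_def)
  have L: "lattice_term \<tau>' v = ?j ^ 2 * lattice_term \<tau> (act v)" for v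
  proof -
    obtain m n where v: "v = (m, n)" by force
    have "of_int m * \<tau>' + of_int n = (of_int (m * a + n * c) * \<tau> + of_int (m * b + n * d)) / ?j"
    proof -
      have "\<tau>' * ?j = of_int a * \<tau> + of_int b" using j by (simp add: \<tau>'_def)
      moreover have "(of_int m * \<tau>' + of_int n) * ?j = of_int m * (\<tau>' * ?j) + of_int n * ?j"
        by (simp only: distrib_right mult.assoc)
      ultimately have "(of_int m * \<tau>' + of_int n) * ?j = of_int (m * a + n * c) * \<tau> + of_int (m * b + n * d)"
        by (simp add: algebra_simps)
      then show ?thesis using j by (simp add: eq_divide_eq)
    qed
    then show ?thesis by (simp add: v lattice_term_def act_def power_divide)
  qed
  have bij: "bij act" by (rule bij_betw_byWitness[where f' = pull]) (auto simp: act_pull pull_act)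
  have "((\<lambda>v. \<eta>' (act v) * (lattice_term \<tau> (act v) - lattice_term \<tau> (act v + act w)))
      has_sum 2 * eisenstein \<eta>' \<tau>) UNIV"
    using eisenstein_telescoped[OF \<tau> alt'[unfolded wA]]
    by (subst has_sum_reindex_bij_betw[OF bij, of "\<lambda>v. \<eta>' v * (lattice_term \<tau> v - lattice_term \<tau> (v + act w))"])
  then have "((\<lambda>v. ?j ^ 2 * (\<eta>' (act v) * (lattice_term \<tau> (act v) - lattice_term \<tau> (act v + act w))))
      has_sum ?j ^ 2 * (2 * eisenstein \<eta>' \<tau>)) UNIV"
    by (rule has_sum_cmult_right)
  also have "(\<lambda>v. ?j ^ 2 * (\<eta>' (act v) * (lattice_term \<tau> (act v) - lattice_term \<tau> (act v + act w))))
      = (\<lambda>v. \<eta> v * (lattice_term \<tau>' v - lattice_term \<tau>' (v + w)))"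
    unfolding L act_add \<eta>'_pull pull_act by (simp add: right_diff_distrib mult_ac)
  finally have "2 * eisenstein \<eta> \<tau>' = ?j ^ 2 * (2 * eisenstein \<eta>' \<tau>)"
    using eisenstein_telescoped[OF \<tau>' \<eta>] has_sum_unique by blast
  then show "eisenstein \<eta> ((of_int a * \<tau> + of_int b) / ?j) = ?j ^ 2 * eisenstein \<eta>' \<tau>"
    by (simp add: \<tau>'_def)
qed

section \<open>The Gromov-Witten potentials as Eisenstein series\<close>

text \<open>Up to a factor, the inverse Fourier transform modulo \<open>8\<close>, in the second variable, of the condition
  \<open>m\<close> odd, \<open>d \<equiv> - s m (mod 4)\<close> on the terms \<open>d Q\<^sup>m\<^sup>d\<close> of the Lambert series.\<close>

definition gw_weight :: "int \<Rightarrow> int \<times> int \<Rightarrow> complex" where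
  "gw_weight s = (\<lambda>(m, n). if odd m \<and> even n then \<i> powi (s * m * (n div 2)) else 0)"

lemma i_powi_cong:
  assumes "[k = l] (mod 4)"
  shows "\<i> powi k = \<i> powi l"
proof -
  obtain t where t: "k = l + 4 * t" using assms by (metis cong_iff_lin cong_sym)
  have "\<i> powi (4 * t) = (\<i> powi 4) powi t" by (simp only: power_int_mult)
  then show ?thesis by (simp add: t power_int_add)
qed

lemma gw_weight_uminus: "gw_weight s (- v) = gw_weight s v"
proof (cases v)
  case (Pair m n)
  have "(- n) div 2 = - (n div 2)" if "even n" using that by presburger
  then show ?thesis by (auto simp: Pair gw_weight_def)
qed

text \<open>Adding 4 to n adds 2 to n div 2, which multiplies the weight by \<i>^(2 s m) = -1, as s
  m is odd on the support.\<close>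

lemma alternating_gw_weight:
  assumes "odd s"
  shows "alternating_weight (gw_weight s) (0, 4)"
  unfolding alternating_weight_def
proof (intro conjI allI)
  show "norm (gw_weight s v) \<le> 1" for v
    by (cases v) (simp add: gw_weight_def norm_power_int)
  fix m n i j
  have "\<i> powi (s * (m + 8 * i) * (n div 2 + 4 * j)) = \<i> powi (s * m * (n div 2))"
  proof (rule i_powi_cong)
    have "s * (m + 8 * i) * (n div 2 + 4 * j) = s * m * (n div 2) + 4 * (s * (m * j + 2 * i * (n div 2) + 8 * i * j))"
      by (simp add: algebra_simps)
    then show "[s * (m + 8 * i) * (n div 2 + 4 * j) = s * m * (n div 2)] (mod 4)"
      by (simp add: cong_def)
  qed
  moreover have "(n + 8 * j) div 2 = n div 2 + 4 * j" by simp
  ultimately show "gw_weight s (m + 8 * i, n + 8 * j) = gw_weight s (m, n)"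
    by (simp add: gw_weight_def)
next
  fix v :: "int \<times> int"
  obtain m n where v: "v = (m, n)" by force
  have "\<i> powi (s * m * (n div 2 + 2)) = - (\<i> powi (s * m * (n div 2)))" if "odd m"
  proof -
    have "odd (s * m)" using that assms by simp
    then obtain t where "s * m = 2 * t + 1" by (elim oddE)
    then have "s * m * (n div 2 + 2) = (s * m * (n div 2) + 2) + 4 * t" by (simp add: algebra_simps)
    then have "\<i> powi (s * m * (n div 2 + 2)) = \<i> powi (s * m * (n div 2) + 2)"
      by (intro i_powi_cong) (simp add: cong_def)
    then show ?thesis by (simp add: power_int_add)
  qed
  moreover have "(n + 4) div 2 = n div 2 + 2" by simp
  ultimately show "gw_weight s (v + (0, 4)) = - gw_weight s v"
    by (simp add: gw_weight_def v)
qed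

text \<open>Only even residues 2 t contribute, and \<open>zeta8 ^ 2\<close> is \<i>. The transform
  is thus the sum of x^t over t < 4 for the fourth root of unity x = \<i>^(s m + d), which is 4 or
  0.\<close>

lemma row_dft_gw_weight:
  "row_dft (gw_weight s) m d = (if odd m \<and> 4 dvd s * int m + int d then 4 else 0)"
proof (cases "odd m")
  case True
  define k where "k = s * int m + int d"
  define x where "x = \<i> powi k"
  have zeta: "zeta8 ^ 2 = \<i>"
  proof -
    have "zeta8 ^ 2 = exp (\<i> * of_real (pi / 2))"
      unfolding zeta8_def by (subst exp_double[symmetric]) (simp add: mult_ac)
    then show ?thesis by (simp only: cis_conv_exp[symmetric] cis_pi_half)
  qed
  have sum8: "(\<Sum>j<8::nat. g j) = g 0 + g 1 + g 2 + g 3 + g 4 + g 5 + g 6 + g 7" for g :: "nat \<Rightarrow> complex"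
    by (simp add: eval_nat_numeral)
  have term_odd: "gw_weight s (int m, 1) = 0" "gw_weight s (int m, 3) = 0"
      "gw_weight s (int m, 5) = 0" "gw_weight s (int m, 7) = 0"
    by (simp_all add: gw_weight_def)
  have term_even: "gw_weight s (int m, int (2 * t)) * zeta8 ^ (2 * t * d) = x ^ t" for t
  proof -
    have "zeta8 ^ (2 * t * d) = \<i> ^ (d * t)" by (simp only: power_mult zeta mult.commute[of d t])
    also have "\<dots> = \<i> powi (int d * int t)" by (simp flip: power_int_of_nat)
    finally have "gw_weight s (int m, int (2 * t)) * zeta8 ^ (2 * t * d)
        = \<i> powi (s * int m * int t) * \<i> powi (int d * int t)"
      using True by (simp add: gw_weight_def)
    also have "\<dots> = \<i> powi (k * int t)" by (simp add: k_def distrib_right power_int_add)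
    also have "\<dots> = x ^ t" by (simp add: x_def power_int_mult)
    finally show ?thesis .
  qed
  have "row_dft (gw_weight s) m d = 1 + x + x ^ 2 + x ^ 3"
    unfolding row_dft_def sum8
    using term_even[of 0] term_even[of 1] term_even[of 2] term_even[of 3] by (simp add: term_odd)
  also have "\<dots> = (if 4 dvd k then 4 else 0)"
  proof -
    have x: "x = \<i> powi (k mod 4)" unfolding x_def by (rule i_powi_cong) (simp add: cong_def)
    have "k mod 4 \<in> {0, 1, 2, 3}" by auto
    then consider "k mod 4 = 0" | "k mod 4 = 1" | "k mod 4 = 2" | "k mod 4 = 3" by blast
    then show ?thesis
      by cases (simp_all add: x dvd_eq_mod_eq_0 power2_eq_square power3_eq_cube)
  qed
  finally show ?thesis using True by (simp add: k_def)
qed (simp add: row_dft_def gw_weight_def)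

text \<open>The index k carries the linear factor and so belongs to d, while l belongs to m; this
  explains the swapped pair.\<close>

lemma residue_class_has_sum:
  fixes w :: complex
  assumes w: "norm w < 1" and "r > 0" "t > 0"
  shows "((\<lambda>(m, d). of_nat d * w ^ (m * d)) has_sum
           (\<Sum>\<^sub>\<infinity>(k, l)\<in>UNIV. of_nat (4 * k + r) * w ^ ((4 * k + r) * (4 * l + t))))
           (range (\<lambda>(k, l). (4 * l + t, 4 * k + r)))"
proof -
  have "((\<lambda>(k, l). of_nat (4 * k + r) * w ^ ((4 * k + r) * (4 * l + t))) has_sum
      (\<Sum>\<^sub>\<infinity>(k, l)\<in>UNIV. of_nat (4 * k + r) * w ^ ((4 * k + r) * (4 * l + t)))) UNIV"
    using has_sum_infsum[OF abs_summable_summable[OF gw_series_abs_summable[OF w assms(2,3), of 4 0 r]]]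
    by simp
  then show ?thesis
    by (subst has_sum_reindex) (auto simp: inj_on_def o_def case_prod_unfold mult_ac)
qed

lemma residue_class_eq:
  fixes r t :: nat
  assumes "r < 4" "t < 4"
  shows "range (\<lambda>(k, l). (4 * l + t, 4 * k + r)) = {(m, d). m mod 4 = t \<and> d mod 4 = r}"
proof -
  have "(m, d) \<in> range (\<lambda>(k, l). (4 * l + t, 4 * k + r))" if "m mod 4 = t" "d mod 4 = r" for m d
  proof (rule range_eqI)
    show "(m, d) = (case (d div 4, m div 4) of (k, l) \<Rightarrow> (4 * l + t, 4 * k + r))"
      using that by auto
  qed
  then show ?thesis using assms by auto
qed

text \<open>The case r = t = 1 serves \<phi>, and r = 1, t = 3 serves \<psi>. The condition on (m,
  d) is invariant under negation modulo 4, which accounts for the second class.\<close>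

lemma lambert_two_residue_classes:
  fixes c :: "nat \<Rightarrow> nat \<Rightarrow> complex"
  assumes w: "norm w < 1" and rt: "r = 1 \<and> t = 1 \<or> r = 1 \<and> t = 3"
    and c: "\<And>m d. c m d = (if m mod 4 = t \<and> d mod 4 = r \<or> m mod 4 = 4 - t \<and> d mod 4 = 4 - r then 4 else 0)"
  shows "lambert c w =
    4 * ((\<Sum>\<^sub>\<infinity>(k, l)\<in>UNIV. of_nat (4 * k + r) * w ^ ((4 * k + r) * (4 * l + t)))
       + (\<Sum>\<^sub>\<infinity>(k, l)\<in>UNIV. of_nat (4 * k + (4 - r)) * w ^ ((4 * k + (4 - r)) * (4 * l + (4 - t)))))"
    (is "_ = 4 * ?S")
proof -
  let ?D = "\<lambda>r t. {(m, d). m mod 4 = t \<and> d mod 4 = (r :: nat)} :: (nat \<times> nat) set"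
  have "((\<lambda>(m, d). of_nat d * w ^ (m * d)) has_sum ?S) (?D r t \<union> ?D (4 - r) (4 - t))"
  proof (rule has_sum_Un_disjoint)
    have rt': "0 < r" "0 < t" "r < 4" "t < 4" "0 < 4 - r" "0 < 4 - t" "4 - r < 4" "4 - t < 4"
      using rt by auto
    show "((\<lambda>(m, d). of_nat d * w ^ (m * d)) has_sum
        (\<Sum>\<^sub>\<infinity>(k, l)\<in>UNIV. of_nat (4 * k + r) * w ^ ((4 * k + r) * (4 * l + t)))) (?D r t)"
      using residue_class_has_sum[OF w rt'(1,2)] unfolding residue_class_eq[OF rt'(3,4)] .
    show "((\<lambda>(m, d). of_nat d * w ^ (m * d)) has_sum
        (\<Sum>\<^sub>\<infinity>(k, l)\<in>UNIV. of_nat (4 * k + (4 - r)) * w ^ ((4 * k + (4 - r)) * (4 * l + (4 - t)))))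
        (?D (4 - r) (4 - t))"
      using residue_class_has_sum[OF w rt'(5,6)] unfolding residue_class_eq[OF rt'(7,8)] .
    show "?D r t \<inter> ?D (4 - r) (4 - t) = {}" using rt by auto
  qed
  from has_sum_cmult_right[OF this, of 4]
  have "((\<lambda>p. 4 * (case p of (m, d) \<Rightarrow> of_nat d * w ^ (m * d))) has_sum 4 * ?S) (?D r t \<union> ?D (4 - r) (4 - t))" .
  also have "?this \<longleftrightarrow> ((\<lambda>(m, d). of_nat d * c m d * w ^ (m * d)) has_sum 4 * ?S) ({1..} \<times> {1..})"
  proof (rule has_sum_cong_neutral)
    fix p assume "p \<in> ({1..} \<times> {1..}) - (?D r t \<union> ?D (4 - r) (4 - t))"
    then show "(case p of (m, d) \<Rightarrow> of_nat d * c m d * w ^ (m * d)) = 0" by (cases p) (auto simp: c)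
  next
    fix p assume "p \<in> (?D r t \<union> ?D (4 - r) (4 - t)) - ({1..} \<times> {1..})"
    then show "4 * (case p of (m, d) \<Rightarrow> of_nat d * w ^ (m * d)) = 0" using rt by (cases p) (auto simp: not_le)
  next
    fix p assume "p \<in> (?D r t \<union> ?D (4 - r) (4 - t)) \<inter> ({1..} \<times> {1..})"
    then show "4 * (case p of (m, d) \<Rightarrow> of_nat d * w ^ (m * d)) = (case p of (m, d) \<Rightarrow> of_nat d * c m d * w ^ (m * d))"
      by (cases p) (simp add: c)
  qed
  finally show ?thesis unfolding lambert_def by (rule infsumI)
qed

lemma lambert_gw_phi:
  assumes "norm w < 1"
  shows "lambert (row_dft (gw_weight (- 1))) w = 4 * gw_phi w"
proof -
  have "odd m \<and> 4 dvd - 1 * int m + int d \<longleftrightarrow>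
      m mod 4 = 1 \<and> d mod 4 = 1 \<or> m mod 4 = 4 - 1 \<and> d mod 4 = 4 - 1" for m d :: nat
    by presburger
  then show ?thesis
    using lambert_two_residue_classes[OF assms, of 1 1 "row_dft (gw_weight (- 1))"]
    by (simp add: row_dft_gw_weight gw_phi_def)
qed

text \<open>Exchanging k and l in the second of the two sums gives both the same powers of w, with
  coefficients adding up to (4 k + 1) + (4 l + 3) = 4 (k + l + 1). Together with the factor 4 of the
  Fourier transform this makes 16.\<close>

lemma lambert_gw_psi:
  assumes w: "norm w < 1"
  shows "lambert (row_dft (gw_weight 1)) w = 16 * gw_psi w"
proof -
  have "odd m \<and> 4 dvd 1 * int m + int d \<longleftrightarrow>
      m mod 4 = 3 \<and> d mod 4 = 1 \<or> m mod 4 = 4 - 3 \<and> d mod 4 = 4 - 1" for m d :: nat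
    by presburger
  then have "lambert (row_dft (gw_weight 1)) w =
      4 * ((\<Sum>\<^sub>\<infinity>(k, l)\<in>UNIV. of_nat (4 * k + 1) * w ^ ((4 * k + 1) * (4 * l + 3)))
         + (\<Sum>\<^sub>\<infinity>(k, l)\<in>UNIV. of_nat (4 * k + 3) * w ^ ((4 * k + 3) * (4 * l + 1))))"
    using lambert_two_residue_classes[OF assms, of 1 3 "row_dft (gw_weight 1)"]
    by (simp add: row_dft_gw_weight)
  also have "(\<Sum>\<^sub>\<infinity>(k, l)\<in>UNIV. of_nat (4 * k + 3) * w ^ ((4 * k + 3) * (4 * l + 1)))
      = (\<Sum>\<^sub>\<infinity>(k, l)\<in>UNIV. of_nat (4 * l + 3) * w ^ ((4 * k + 1) * (4 * l + 3)))"
    by (rule infsum_reindex_bij_witness[where i = prod.swap and j = prod.swap]) (auto simp: mult_ac)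
  also have "(\<Sum>\<^sub>\<infinity>(k, l)\<in>UNIV. of_nat (4 * k + 1) * w ^ ((4 * k + 1) * (4 * l + 3))) + \<dots>
      = (\<Sum>\<^sub>\<infinity>p. 4 * (case p of (k, l) \<Rightarrow> of_nat (k + l + 1) * w ^ ((4 * k + 1) * (4 * l + 3))))"
  proof (subst infsum_add[symmetric])
    show "(\<lambda>(k, l). of_nat (4 * k + 1) * w ^ ((4 * k + 1) * (4 * l + 3))) summable_on UNIV"
      using abs_summable_summable[OF gw_series_abs_summable[OF w, of 1 3 4 0 1]] by simp
    show "(\<lambda>(k, l). of_nat (4 * l + 3) * w ^ ((4 * k + 1) * (4 * l + 3))) summable_on UNIV"
      using abs_summable_summable[OF gw_series_abs_summable[OF w, of 1 3 0 4 3]] by simp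
  qed (auto intro!: infsum_cong simp: algebra_simps)
  also have "\<dots> = 4 * gw_psi w" unfolding gw_psi_def by (rule infsum_cmult_right')
  finally show ?thesis by simp
qed

text \<open>Row 0 vanishes because the weight is supported on odd m. The weight is even, so the two
  Lambert series coincide and \<pi>^2 / 16 doubles.\<close>

lemma eisenstein_gw_weight:
  assumes "Im \<tau> > 0" "odd s"
  shows "eisenstein (gw_weight s) \<tau> = - (of_real pi ^ 2 / 8) * lambert (row_dft (gw_weight s)) (q_power (1 / 8) \<tau>)"
  unfolding eisenstein_eq_lambert[OF assms(1) alternating_gw_weight[OF assms(2)]] gw_weight_uminus
  by (simp add: gw_weight_def)

text \<open>As a and d are odd, the support is preserved. On it m^2 and a d are 1 modulo 4, which
  reduces the new exponent modulo 4 to the old one minus s d (b div 2).\<close>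

lemma gw_weight_Gamma2:
  assumes det: "a * d - b * c = 1" and "even b" "even c"
  shows "gw_weight s (m * d - n * c, n * a - m * b) = \<i> powi (- s * d * (b div 2)) * gw_weight s (m, n)"
proof (cases "odd m \<and> even n")
  case True
  obtain b' where b: "b = 2 * b'" using assms by (elim evenE)
  obtain c' where c: "c = 2 * c'" using assms by (elim evenE)
  obtain n' where n: "n = 2 * n'" using True by (elim evenE conjE)
  obtain k where m: "m = 2 * k + 1" using True by (elim oddE conjE)
  have ad: "a * d = 1 + 4 * (b' * c')" using det by (simp add: b c)
  have "odd (a * d)" unfolding ad by simp
  then have odd_ad: "odd a" "odd d" by simp_all
  have "[s * (m * d - n * c) * (n' * a - m * b') = - s * d * b' + s * m * n'] (mod 4)"
  proof -
    have "s * (m * d - n * c) * (n' * a - m * b')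
        = s * (m * n') * (a * d) - s * d * b' * (m * m) - 4 * (s * n' * c' * (n' * a - m * b'))"
      by (simp add: n c algebra_simps)
    \<comment> \<open>The multiples of 4 come from a d = 1 + 4 b' c' and m^2 = 1 + 4 (k^2 +
      k).\<close>
    also have "\<dots> = (- s * d * b' + s * m * n')
        + 4 * (s * (m * n') * (b' * c') - s * d * b' * (k * k + k) - s * n' * c' * (n' * a - m * b'))"
      unfolding ad by (simp add: m algebra_simps)
    finally have eq: "s * (m * d - n * c) * (n' * a - m * b') = \<dots>" .
    have "[u + 4 * v = u] (mod 4)" for u v :: int by (simp add: cong_def)
    then show ?thesis unfolding eq .
  qed
  moreover have "(n * a - m * b) div 2 = n' * a - m * b'" by (simp add: n b algebra_simps)
  ultimately have eq: "\<i> powi (s * (m * d - n * c) * ((n * a - m * b) div 2)) = \<i> powi (- s * d * b' + s * m * n')"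
    by (simp add: i_powi_cong)
  have lhs: "gw_weight s (m * d - n * c, n * a - m * b) = \<i> powi (s * (m * d - n * c) * ((n * a - m * b) div 2))"
    using True odd_ad assms by (simp add: gw_weight_def)
  have rhs: "gw_weight s (m, n) = \<i> powi (s * m * n')" using True by (simp add: gw_weight_def n)
  have b_half: "b div 2 = b'" by (simp add: b)
  show ?thesis unfolding lhs rhs b_half eq by (rule power_int_add) simp
next
  case False
  have "a * d = 1 + b * c" using det by simp
  then have "odd (a * d)" using assms(2) by simp
  then have "odd a" "odd d" by simp_all
  with False assms show ?thesis by (auto simp: gw_weight_def)
qed

section \<open>The multiplier system on \<Gamma>(2)\<close>

lemma i_powi_neg_shift: "even b \<Longrightarrow> - s * - d * (- b div 2) = - s * d * (b div 2)" for b d s :: int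
proof -
  assume "even b"
  then have "- b div 2 = - (b div 2)" by presburger
  then show "- s * - d * (- b div 2) = - s * d * (b div 2)" by simp
qed

lemma PSL_class_eq: "PSL_class A = {A, - A}"
proof -
  have "mat 1 ** A = A" by simp
  moreover have "(- mat 1) ** A = - A"
    by (simp add: vec_eq_iff matrix_matrix_mult_def sum_2 forall_2 mat_def)
  ultimately show ?thesis by (auto simp: PSL_class_def r_coset_def SL2Z_def)
qed

lemma PSL_class_in_PGamma_2D:
  assumes "PSL_class A \<in> PGamma 2"
  shows "even (A $ 1 $ 2)" "even (A $ 2 $ 1)"
proof -
  obtain B where B: "PSL_class A = PSL_class B" "\<forall>i j. [B $ i $ j = mat 1 $ i $ j] (mod 2)"
    using assms by (auto simp: PGamma_def)
  then have "A = B \<or> A = - B" using PSL_class_eq by auto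
  moreover have "even (B $ 1 $ 2)" "even (B $ 2 $ 1)"
    using B(2)[rule_format, of 1 2] B(2)[rule_format, of 2 1] by (simp_all add: mat_def cong_0_iff)
  ultimately show "even (A $ 1 $ 2)" "even (A $ 2 $ 1)" by auto
qed

text \<open>For even \<open>b\<close> the exponent \<open>- s d b / 2\<close> is the same for \<open>A\<close> and \<open>- A\<close>, so the choice of the
  representative is immaterial.\<close>

definition gw_multiplier :: "int \<Rightarrow> (int^2^2) set \<Rightarrow> complex" where
  "gw_multiplier s g = (let A = SOME A. A \<in> g in \<i> powi (- s * A $ 2 $ 2 * (A $ 1 $ 2 div 2)))"

lemma gw_multiplier_PSL_class:
  assumes "PSL_class A \<in> PGamma 2"
  shows "gw_multiplier s (PSL_class A) = \<i> powi (- s * A $ 2 $ 2 * (A $ 1 $ 2 div 2))"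
proof -
  have "(SOME B. B \<in> PSL_class A) \<in> PSL_class A" by (rule someI[of _ A]) (simp add: PSL_class_eq)
  then consider "(SOME B. B \<in> PSL_class A) = A" | "(SOME B. B \<in> PSL_class A) = - A"
    by (auto simp: PSL_class_eq)
  then show ?thesis
  proof cases
    case 2
    then have "gw_multiplier s (PSL_class A) = \<i> powi (- s * - (A $ 2 $ 2) * (- (A $ 1 $ 2) div 2))"
      by (simp add: gw_multiplier_def Let_def)
    then show ?thesis
      unfolding i_powi_neg_shift[OF PSL_class_in_PGamma_2D(1)[OF assms]] .
  qed (simp add: gw_multiplier_def Let_def)
qed

text \<open>All values are powers of \<i>, hence nonzero and of modulus 1, and w can be taken as the
  quotient of v(g h) by v(g) v(h).\<close>

lemma multiplier_system_gw_multiplier: "multiplier_system \<Gamma> (gw_multiplier s)"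
proof -
  have "gw_multiplier s g \<noteq> 0" for g by (simp add: gw_multiplier_def Let_def)
  then have "gw_multiplier s (g \<otimes>\<^bsub>PSL2Z\<^esub> h)
      = gw_multiplier s (g \<otimes>\<^bsub>PSL2Z\<^esub> h) / (gw_multiplier s g * gw_multiplier s h)
        * gw_multiplier s g * gw_multiplier s h" for g h
    by simp
  moreover have "cmod (gw_multiplier s g) = 1" for g
    by (simp add: gw_multiplier_def Let_def norm_power_int)
  ultimately show ?thesis
    unfolding multiplier_system_def
    by (intro conjI ballI exI[of _ "\<lambda>g h. gw_multiplier s (g \<otimes>\<^bsub>PSL2Z\<^esub> h) / (gw_multiplier s g * gw_multiplier s h)"])
qed

lemma modular_form_eisenstein_gw_weight:
  assumes s: "odd s" and f: "\<And>\<tau>. \<tau> \<in> upper_half_plane \<Longrightarrow> f \<tau> = C * eisenstein (gw_weight s) \<tau>"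
  shows "modular_form (PGamma 2) 2 (gw_multiplier s) f"
  unfolding modular_form_def
proof (intro conjI ballI impI)
  note alt = alternating_gw_weight[OF s]
  show "multiplier_system (PGamma 2) (gw_multiplier s)" by (rule multiplier_system_gw_multiplier)
  have "(\<lambda>\<tau>. C * eisenstein (gw_weight s) \<tau>) holomorphic_on upper_half_plane"
    using eisenstein_holomorphic[OF alt] by (intro holomorphic_intros)
  then show "f holomorphic_on upper_half_plane"
    by (rule holomorphic_transform) (simp add: f)
  fix A :: "int^2^2" assume A: "A \<in> carrier SL2Z"
  define a b c d where abcd: "a = A $ 1 $ 1" "b = A $ 1 $ 2" "c = A $ 2 $ 1" "d = A $ 2 $ 2"
  have det: "a * d - b * c = 1" using A by (simp add: SL2Z_def det_2 abcd)
  let ?\<eta> = "\<lambda>(m, n). gw_weight s (m * d - n * c, n * a - m * b)"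
  have transf: "automorphy_factor A \<tau> \<noteq> 0"
      "f (moebius_act A \<tau>) = C * (automorphy_factor A \<tau> ^ 2 * eisenstein ?\<eta> \<tau>)"
    if "\<tau> \<in> upper_half_plane" for \<tau>
  proof -
    have \<tau>: "Im \<tau> > 0" using that by (simp add: upper_half_plane_def)
    show "automorphy_factor A \<tau> \<noteq> 0"
      using Im_moebius_pos(1)[OF det \<tau>] by (simp add: automorphy_factor_def abcd)
    have "moebius_act A \<tau> \<in> upper_half_plane"
      using Im_moebius_pos(2)[OF det \<tau>]
      by (simp add: upper_half_plane_def moebius_act_def automorphy_factor_def abcd)
    moreover have "eisenstein (gw_weight s) (moebius_act A \<tau>) = automorphy_factor A \<tau> ^ 2 * eisenstein ?\<eta> \<tau>"
      using eisenstein_moebius(2)[OF det \<tau> alt] by (simp add: moebius_act_def automorphy_factor_def abcd)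
    ultimately show "f (moebius_act A \<tau>) = C * (automorphy_factor A \<tau> ^ 2 * eisenstein ?\<eta> \<tau>)"
      by (simp add: f)
  qed
  show "f (moebius_act A \<tau>) = gw_multiplier s (PSL_class A) * automorphy_factor A \<tau> powi 2 * f \<tau>"
    if g: "PSL_class A \<in> PGamma 2" and \<tau>: "\<tau> \<in> upper_half_plane" for \<tau>
  proof -
    have "even b" "even c" using PSL_class_in_PGamma_2D[OF g] by (simp_all add: abcd)
    \<comment> \<open>On \<Gamma>(2) the transformed weight is a scalar multiple of the original
      one, and the scalar leaves both sums.\<close>
    then have "?\<eta> = (\<lambda>v. gw_multiplier s (PSL_class A) * gw_weight s v)"
      unfolding gw_multiplier_PSL_class[OF g] abcd(2,4)[symmetric]
      by (auto simp: gw_weight_Gamma2[OF det])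
    then have "eisenstein ?\<eta> \<tau> = gw_multiplier s (PSL_class A) * eisenstein (gw_weight s) \<tau>"
      by (simp add: eisenstein_def lattice_row_def mult.assoc infsum_cmult_right')
    then show ?thesis by (simp add: transf(2)[OF \<tau>] f[OF \<tau>] power2_eq_square)
  qed
  \<comment> \<open>\<i> is supplied as a point of the upper half plane; the transformed weight is
    independent of it.\<close>
  obtain e where e: "\<And>\<tau>. \<tau> \<in> upper_half_plane \<Longrightarrow>
      (\<lambda>n. e n * q_power (of_nat n / of_nat 8) \<tau>) sums eisenstein ?\<eta> \<tau>"
    using eisenstein_q_expansion[OF eisenstein_moebius(1)[OF det _ alt, of \<i>]] by auto
  show "has_fractional_q_expansion (\<lambda>\<tau>. automorphy_factor A \<tau> powi - 2 * f (moebius_act A \<tau>))"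
    unfolding has_fractional_q_expansion_def
  proof (intro exI[of _ 8] conjI exI[of _ "\<lambda>n. C * e n"] ballI)
    fix \<tau> assume \<tau>: "\<tau> \<in> upper_half_plane"
    have "automorphy_factor A \<tau> powi - 2 * f (moebius_act A \<tau>) = C * eisenstein ?\<eta> \<tau>"
      using transf[OF \<tau>] by (simp add: power_int_minus)
    then show "(\<lambda>n. C * e n * q_power (of_nat n / of_nat 8) \<tau>) sums
        (automorphy_factor A \<tau> powi - 2 * f (moebius_act A \<tau>))"
      using sums_mult[OF e[OF \<tau>], of C] by (simp add: mult.assoc)
  qed simp
qed

theorem mainTheorem3:
  shows "(\<exists>k v. modular_form (PGamma 2) k v (\<lambda>\<tau>. gw_phi (q_power (1 / 8) \<tau>))) \<and>
         (\<exists>k v. modular_form (PGamma 2) k v (\<lambda>\<tau>. gw_psi (q_power (1 / 8) \<tau>)))"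
proof
  have Q: "norm (q_power (1 / 8) \<tau>) < 1" "Im \<tau> > 0" if "\<tau> \<in> upper_half_plane" for \<tau>
    using that norm_q_power_eighth_less_1 by (simp_all add: upper_half_plane_def)
  have "modular_form (PGamma 2) 2 (gw_multiplier (- 1)) (\<lambda>\<tau>. gw_phi (q_power (1 / 8) \<tau>))"
  proof (rule modular_form_eisenstein_gw_weight)
    \<comment> \<open>The constant is the inverse of -(\<pi>^2 / 8) * 4.\<close>
    show "gw_phi (q_power (1 / 8) \<tau>) = - 2 / of_real pi ^ 2 * eisenstein (gw_weight (- 1)) \<tau>"
      if "\<tau> \<in> upper_half_plane" for \<tau>
      using Q[OF that] by (simp add: eisenstein_gw_weight lambert_gw_phi)
  qed simp
  then show "\<exists>k v. modular_form (PGamma 2) k v (\<lambda>\<tau>. gw_phi (q_power (1 / 8) \<tau>))" by blast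
  have "modular_form (PGamma 2) 2 (gw_multiplier 1) (\<lambda>\<tau>. gw_psi (q_power (1 / 8) \<tau>))"
  proof (rule modular_form_eisenstein_gw_weight)
    \<comment> \<open>The constant is the inverse of -(\<pi>^2 / 8) * 16.\<close>
    show "gw_psi (q_power (1 / 8) \<tau>) = - 1 / (2 * of_real pi ^ 2) * eisenstein (gw_weight 1) \<tau>"
      if "\<tau> \<in> upper_half_plane" for \<tau>
      using Q[OF that] by (simp add: eisenstein_gw_weight lambert_gw_psi)
  qed simp
  then show "\<exists>k v. modular_form (PGamma 2) k v (\<lambda>\<tau>. gw_psi (q_power (1 / 8) \<tau>))" by blast
qed

end
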